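(* Let $E_o \subset \mathbb{Z}$ be a set of positive upper Banach density. Then for every positive integer $m$ there exists a positive integer $k$ such that for every finite set $F \subset \mathbb{Z}$ with $|F| = m$ there are $x,y,z \in E_o$ such that $$k^2 F \subset \{ (u-x)^2 + (v-y)^2 - (w-z)^2 : u,v,w \in E_o \}.$$ Moreover, if $E_o \subset \mathbb{Z}$ is an aperiodic Bohr$_o$-set, then every integer can be written in the form $u^2 + v^2 - w^2$ for some $u,v,w \in E_o$.
   Context: Upper Banach density: for $E \subset \mathbb{Z}$ and $F_n = [-n,n] \cap \mathbb{Z}$, $d^*(E) = \sup\{ \limsup_n |E \cap (F_n + a_n)|/|F_n| : (a_n) \text{ a sequence in } \mathbb{Z}\}$. $E$ has positive upper Banach density if $d^*(E)>0$. $E \subset \mathbb{Z}$ is an aperiodic Bohr$_o$-set if there exist a compact, connected, second countable abelian group $K$ with Haar probability measure $m_K$, a homomorphism $\tau : \mathbb{Z} \to K$ with dense image, and an open set $U \subset K$ containing the identity element of $K$ with $m_K(\overline{U}) = m_K(U)$ such that $E = \tau^{-1}(U)$. Notation: $k^2F=\{k^2 f : f \in F\}$. *)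

theory Defs
  imports "HOL-Analysis.Analysis" "HOL-Probability.Probability"
begin

definition window :: "nat \<Rightarrow> int set" where
  "window n = {- int n..int n}"

definition upper_Banach_density :: "int set \<Rightarrow> ereal" where
  "upper_Banach_density E =
     (SUP a :: nat \<Rightarrow> int.
        limsup (\<lambda>n. ereal (real (card (E \<inter> (\<lambda>j. j + a n) ` window n)) / real (card (window n)))))"

text \<open>On a compact second countable Hausdorff group every Borel probability measure is regular,
  so a translation-invariant one is the Haar probability measure.\<close>

definition Haar_prob_measure ::
    "'k::{topological_ab_group_add, t2_space, second_countable_topology} measure \<Rightarrow> bool" where
  "Haar_prob_measure M \<longleftrightarrow>
     prob_space M \<and> sets M = sets borel \<and>
     (\<forall>g. \<forall>A\<in>sets borel. emeasure M ((\<lambda>x. g + x) ` A) = emeasure M A)"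

text \<open>HOL cannot quantify over types inside a formula, so the group \<open>K\<close> is passed as
  the type argument \<open>'k\<close>. A theorem with this predicate as a hypothesis and \<open>'k\<close> free
  covers every choice of \<open>K\<close>, which is what an existential in the hypothesis amounts to.\<close>

definition aperiodic_Bohr_o ::
    "'k::{topological_ab_group_add, t2_space, second_countable_topology} itself \<Rightarrow> int set \<Rightarrow> bool" where
  "aperiodic_Bohr_o K E \<longleftrightarrow>
     compact (UNIV :: 'k set) \<and> connected (UNIV :: 'k set) \<and>
     (\<exists>(M :: 'k measure) (\<tau> :: int \<Rightarrow> 'k) (U :: 'k set).
        Haar_prob_measure M \<and>
        (\<forall>a b. \<tau> (a + b) = \<tau> a + \<tau> b) \<and> closure (range \<tau>) = UNIV \<and>
        open U \<and> 0 \<in> U \<and> emeasure M (closure U) = emeasure M U \<and>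
        E = \<tau> -` U)"

end

theory Submission
  imports Defs
begin

text \<open>Averaging over windows gives an invariant mean on \<open>\<int>\<close> that is positive on \<open>E\<close>, hence one on
  \<open>\<int>\<^sup>3\<close> that is positive on \<open>B = E \<times> E \<times> E\<close>. For \<open>s\<close> dividing \<open>S!\<close>, the quadratic curves
  \<open>t \<mapsto> (2HS!t, Hs + r(f - t\<^sup>2), -Hs + r(f - t\<^sup>2))\<close> with \<open>r = H(S!)\<^sup>2/s\<close> lie on the quadric
  \<open>a\<^sup>2 + b\<^sup>2 - c\<^sup>2 = k\<^sup>2f\<close>, where \<open>k = 2HS!\<close>. Choose \<open>H\<close> such that the part of \<open>1\<^sub>B\<close> that is invariant
  under some multiple of \<open>(0,1,1)\<close> is almost captured by the part invariant under \<open>H(0,1,1)\<close>. By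
  van der Corput's inequality the average of \<open>1\<^sub>B\<close> over \<open>t\<close> only sees this part, on which the quadratic
  terms act almost trivially, so only the shifts by \<open>2HS!t(1,0,0) + Hs(0,1,-1)\<close> remain. Averaging these
  over differences \<open>s - s'\<close> and \<open>t - t'\<close> gives a positive semidefinite form, which is at least
  \<open>\<mu>(Z)\<^sup>2\<close> on a set \<open>Z\<close>; so the set \<open>Z \<subseteq> B\<close> of points without a return for a given \<open>f\<close> has mean
  less than \<open>\<mu>(B)/m\<close>, with \<open>H\<close> and \<open>S\<close> not depending on \<open>f\<close>.

  On a connected group there is no periodic part, and the same inequality shows that
  \<open>(\<tau>(At\<^sup>2 + bt + c), \<tau>(lt + d))\<close> comes arbitrarily close to \<open>0\<close>. This is applied twice to
  \<open>a = T + 2rm\<close>, \<open>c = q + 2rT + 2r\<^sup>2m\<close>, \<open>b = m - c\<close> with \<open>m = n - T\<^sup>2 = 2q + 1\<close>, which satisfies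
  \<open>a\<^sup>2 + b\<^sup>2 - c\<^sup>2 = n\<close>: first to make \<open>\<tau>(m)\<close> small, then to make \<open>\<tau>(a)\<close> and \<open>\<tau>(c)\<close> small.\<close>

section \<open>Invariant means\<close>

definition bounded_fun :: "('a \<Rightarrow> real) \<Rightarrow> bool" where
  "bounded_fun F \<longleftrightarrow> (\<exists>C. \<forall>x. \<bar>F x\<bar> \<le> C)"

lemma bounded_funI: "(\<And>x. \<bar>F x\<bar> \<le> C) \<Longrightarrow> bounded_fun F"
  unfolding bounded_fun_def by blast

lemma bounded_funE:
  assumes "bounded_fun F"
  obtains C where "C \<ge> 0" "\<And>x. \<bar>F x\<bar> \<le> C"
  using assms unfolding bounded_fun_def by (meson abs_ge_zero order_trans)

lemma bounded_fun_const [simp, intro]: "bounded_fun (\<lambda>x. c)"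
  by (rule bounded_funI[of _ "\<bar>c\<bar>"]) simp

lemma bounded_fun_add [simp, intro]:
  assumes "bounded_fun F" "bounded_fun G"
  shows "bounded_fun (\<lambda>x. F x + G x)"
proof -
  obtain C D where "\<And>x. \<bar>F x\<bar> \<le> C" "\<And>x. \<bar>G x\<bar> \<le> D"
    using assms by (meson bounded_funE)
  then have "\<bar>F x + G x\<bar> \<le> C + D" for x
    by (meson abs_triangle_ineq add_mono order_trans)
  then show ?thesis by (rule bounded_funI)
qed

lemma bounded_fun_mult [simp, intro]:
  assumes "bounded_fun F" "bounded_fun G"
  shows "bounded_fun (\<lambda>x. F x * G x)"
proof -
  obtain C D where "C \<ge> 0" "\<And>x. \<bar>F x\<bar> \<le> C" "\<And>x. \<bar>G x\<bar> \<le> D"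
    using assms by (meson bounded_funE)
  then have "\<bar>F x * G x\<bar> \<le> C * D" for x
    by (simp add: abs_mult mult_mono)
  then show ?thesis by (rule bounded_funI)
qed

lemma bounded_fun_minus [simp, intro]: "bounded_fun F \<Longrightarrow> bounded_fun (\<lambda>x. - F x)"
  by (simp add: bounded_fun_def)

lemma bounded_fun_diff [simp, intro]:
  "bounded_fun F \<Longrightarrow> bounded_fun G \<Longrightarrow> bounded_fun (\<lambda>x. F x - G x)"
  using bounded_fun_add[of F "\<lambda>x. - G x"] by simp

lemma bounded_fun_divide [simp, intro]: "bounded_fun F \<Longrightarrow> bounded_fun (\<lambda>x. F x / c)"
  using bounded_fun_mult[of F "\<lambda>_. inverse c"] by (simp add: divide_inverse)

lemma bounded_fun_power [simp, intro]: "bounded_fun F \<Longrightarrow> bounded_fun (\<lambda>x. (F x) ^ n)"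
  by (induction n) auto

lemma bounded_fun_sum [simp, intro]:
  "(\<And>i. i \<in> I \<Longrightarrow> bounded_fun (F i)) \<Longrightarrow> bounded_fun (\<lambda>x. \<Sum>i\<in>I. F i x)"
  by (induction I rule: infinite_finite_induct) auto

lemma bounded_fun_indicator [simp, intro]: "bounded_fun (indicator A)"
  by (rule bounded_funI[of _ 1]) (simp add: indicator_def)

section \<open>Shifts and averages over finite index sets\<close>

definition sh :: "'g::ab_group_add \<Rightarrow> ('g \<Rightarrow> real) \<Rightarrow> 'g \<Rightarrow> real" where
  "sh v F x = F (x + v)"

lemma bounded_fun_sh [simp, intro]: "bounded_fun F \<Longrightarrow> bounded_fun (sh v F)"
  by (auto simp: bounded_fun_def sh_def)

lemma sh_sh: "sh v (sh w F) = sh (v + w) F"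
  by (auto simp: sh_def fun_eq_iff ac_simps)

lemma sh_0 [simp]: "sh 0 F = F"
  by (auto simp: sh_def)

definition av :: "'i set \<Rightarrow> ('i \<Rightarrow> 'g::ab_group_add) \<Rightarrow> ('g \<Rightarrow> real) \<Rightarrow> 'g \<Rightarrow> real" where
  "av I u F x = (\<Sum>i\<in>I. F (x + u i)) / real (card I)"

lemma av_eq_sh: "av I u F = (\<lambda>x. (\<Sum>i\<in>I. sh (u i) F x) / real (card I))"
  by (simp add: av_def sh_def fun_eq_iff)

lemma bounded_fun_av [simp, intro]: "bounded_fun F \<Longrightarrow> bounded_fun (av I u F)"
  unfolding av_eq_sh by auto

text \<open>A finitely additive substitute for an invariant integral. \<open>L\<close> is total as
  HOL requires, but the laws speak of bounded functions, hence the \<open>bounded_fun\<close> side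
  conditions throughout.\<close>

locale inv_mean =
  fixes L :: "('g::ab_group_add \<Rightarrow> real) \<Rightarrow> real"
  assumes L_add: "bounded_fun F \<Longrightarrow> bounded_fun G \<Longrightarrow> L (\<lambda>x. F x + G x) = L F + L G"
    and L_scale: "bounded_fun F \<Longrightarrow> L (\<lambda>x. c * F x) = c * L F"
    and L_nonneg: "bounded_fun F \<Longrightarrow> (\<And>x. 0 \<le> F x) \<Longrightarrow> 0 \<le> L F"
    and L_one: "L (\<lambda>_. 1) = 1"
    and L_shift: "bounded_fun F \<Longrightarrow> L (sh v F) = L F"
begin

lemma L_const: "L (\<lambda>_. c) = c"
  using L_scale[of "\<lambda>_. 1" c] L_one by simp

lemma L_diff:
  assumes "bounded_fun F" "bounded_fun G"
  shows "L (\<lambda>x. F x - G x) = L F - L G"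
  using L_add[of F "\<lambda>x. - 1 * G x"] L_scale[of G "- 1"] assms by simp

lemma L_mono:
  assumes "bounded_fun F" "bounded_fun G" "\<And>x. F x \<le> G x"
  shows "L F \<le> L G"
  using L_nonneg[of "\<lambda>x. G x - F x"] L_diff[of G F] assms by simp

lemma L_sum:
  "finite I \<Longrightarrow> (\<And>i. i \<in> I \<Longrightarrow> bounded_fun (F i)) \<Longrightarrow> L (\<lambda>x. \<Sum>i\<in>I. F i x) = (\<Sum>i\<in>I. L (F i))"
  by (induction I rule: finite_induct) (auto simp: L_const L_add)

lemma L_divide: "bounded_fun F \<Longrightarrow> L (\<lambda>x. F x / c) = L F / c"
  using L_scale[of F "inverse c"] by (simp add: divide_inverse mult.commute)

lemma L_av:
  assumes "finite I" "I \<noteq> {}" "bounded_fun F"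
  shows "L (av I u F) = L F"
proof -
  have "L (av I u F) = (\<Sum>i\<in>I. L (sh (u i) F)) / real (card I)"
    unfolding av_eq_sh using assms by (subst L_divide) (auto simp: L_sum)
  then show ?thesis using assms by (simp add: L_shift)
qed

section \<open>The L2 seminorm of an invariant mean\<close>

definition nrm :: "('g \<Rightarrow> real) \<Rightarrow> real" where
  "nrm F = sqrt (L (\<lambda>x. (F x)\<^sup>2))"

lemma L_square_nonneg: "bounded_fun F \<Longrightarrow> 0 \<le> L (\<lambda>x. (F x)\<^sup>2)"
  by (rule L_nonneg) auto

lemma nrm_nonneg [simp]: "bounded_fun F \<Longrightarrow> 0 \<le> nrm F"
  by (simp add: nrm_def L_square_nonneg)

lemma nrm_square: "bounded_fun F \<Longrightarrow> (nrm F)\<^sup>2 = L (\<lambda>x. (F x)\<^sup>2)"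
  by (simp add: nrm_def L_square_nonneg)

text \<open>Letting \<open>c\<close> vary gives the Cauchy-Schwarz inequality, \<open>c = 1\<close>
  the triangle inequality, and \<open>c = 1\<close> together with \<open>c = - 1\<close> the
  parallelogram law.\<close>

lemma L_square_add:
  assumes "bounded_fun F" "bounded_fun G"
  shows "L (\<lambda>x. (F x + c * G x)\<^sup>2) = (nrm F)\<^sup>2 + 2 * c * L (\<lambda>x. F x * G x) + c\<^sup>2 * (nrm G)\<^sup>2"
proof -
  have "L (\<lambda>x. (F x + c * G x)\<^sup>2)
      = L (\<lambda>x. ((F x)\<^sup>2 + (2 * c) * (F x * G x)) + c\<^sup>2 * (G x)\<^sup>2)"
    by (rule arg_cong[of _ _ L]) (auto simp: power2_eq_square algebra_simps)
  also have "\<dots> = L (\<lambda>x. (F x)\<^sup>2) + L (\<lambda>x. (2 * c) * (F x * G x)) + L (\<lambda>x. c\<^sup>2 * (G x)\<^sup>2)"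
    using assms by (subst L_add; (subst L_add)?; (intro bounded_fun_add bounded_fun_mult bounded_fun_const bounded_fun_power)?; simp)
  also have "\<dots> = (nrm F)\<^sup>2 + 2 * c * L (\<lambda>x. F x * G x) + c\<^sup>2 * (nrm G)\<^sup>2"
    using assms L_scale[of "\<lambda>x. F x * G x" "2 * c"] L_scale[of "\<lambda>x. (G x)\<^sup>2" "c\<^sup>2"]
    by (simp add: nrm_square)
  finally show ?thesis .
qed

text \<open>The quadratic polynomial \<open>L ((F + t G)^2)\<close> in \<open>t\<close> is
  nonnegative, so its discriminant is not positive. As \<open>nrm\<close> is only a seminorm, the
  degenerate case \<open>nrm G = 0\<close> is treated separately.\<close>

lemma Cauchy_Schwarz:
  assumes "bounded_fun F" "bounded_fun G"
  shows "\<bar>L (\<lambda>x. F x * G x)\<bar> \<le> nrm F * nrm G"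
proof -
  define a b c where "a = (nrm F)\<^sup>2" "b = (nrm G)\<^sup>2" "c = L (\<lambda>x. F x * G x)"
  have nonneg: "0 \<le> a + 2 * t * c + t\<^sup>2 * b" for t
    using L_square_add[OF assms, of t] L_square_nonneg[of "\<lambda>x. F x + t * G x"] assms
    by (simp add: a_b_c_def)
  have "c\<^sup>2 \<le> a * b"
  proof (cases "b = 0")
    case True
    have "c = 0"
    proof (rule ccontr)
      assume "c \<noteq> 0"
      \<comment> \<open>At this \<open>t\<close> the remaining affine function
        \<open>a + 2 * t * c\<close> takes the value -1.\<close>
      then have "2 * (- (a + 1) / (2 * c)) * c = - (a + 1)" by simp
      then show False using nonneg[of "- (a + 1) / (2 * c)"] True by simp
    qed
    then show ?thesis using True by simp
  next
    case False
    then have "b > 0" by (simp add: a_b_c_def)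
    have "0 \<le> a + 2 * (- c / b) * c + (- c / b)\<^sup>2 * b" by (rule nonneg)
    also have "\<dots> = a - c\<^sup>2 / b" using False by (simp add: power2_eq_square field_simps)
    finally show ?thesis using \<open>b > 0\<close> by (simp add: field_simps)
  qed
  then have "\<bar>c\<bar>\<^sup>2 \<le> (nrm F * nrm G)\<^sup>2" by (simp add: a_b_c_def power_mult_distrib)
  then have "\<bar>c\<bar> \<le> nrm F * nrm G" by (rule power2_le_imp_le) (use assms in simp)
  then show ?thesis by (simp add: a_b_c_def)
qed

lemma nrm_add:
  assumes "bounded_fun F" "bounded_fun G"
  shows "nrm (\<lambda>x. F x + G x) \<le> nrm F + nrm G"
proof (rule power2_le_imp_le)
  have "(nrm (\<lambda>x. F x + G x))\<^sup>2 = (nrm F)\<^sup>2 + 2 * L (\<lambda>x. F x * G x) + (nrm G)\<^sup>2"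
    using L_square_add[OF assms, of 1] assms by (simp add: nrm_square)
  also have "\<dots> \<le> (nrm F + nrm G)\<^sup>2"
    using Cauchy_Schwarz[OF assms] by (simp add: power2_sum)
  finally show "(nrm (\<lambda>x. F x + G x))\<^sup>2 \<le> (nrm F + nrm G)\<^sup>2" .
qed (use assms in simp)

lemma nrm_scale:
  assumes "bounded_fun F"
  shows "nrm (\<lambda>x. c * F x) = \<bar>c\<bar> * nrm F"
  using assms L_scale[of "\<lambda>x. (F x)\<^sup>2" "c\<^sup>2"]
  by (simp add: nrm_def power_mult_distrib real_sqrt_mult)

lemma nrm_divide: "bounded_fun F \<Longrightarrow> nrm (\<lambda>x. F x / c) = nrm F / \<bar>c\<bar>"
  using nrm_scale[of F "inverse c"] by (simp add: divide_inverse mult.commute)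

lemma nrm_sh [simp]:
  assumes "bounded_fun F"
  shows "nrm (sh v F) = nrm F"
proof -
  have "(\<lambda>x. (sh v F x)\<^sup>2) = sh v (\<lambda>x. (F x)\<^sup>2)" by (simp add: sh_def fun_eq_iff)
  then show ?thesis using L_shift[of "\<lambda>x. (F x)\<^sup>2" v] assms by (simp add: nrm_def)
qed

lemma nrm_le_const:
  assumes "\<And>x. \<bar>F x\<bar> \<le> C"
  shows "nrm F \<le> C"
proof -
  have "C \<ge> 0" using assms[of 0] by linarith
  have "bounded_fun F" using assms by (rule bounded_funI)
  have "(F x)\<^sup>2 \<le> C\<^sup>2" for x
    using assms[of x] by (metis abs_ge_zero power2_abs power_mono)
  then have "L (\<lambda>x. (F x)\<^sup>2) \<le> C\<^sup>2"
    using L_mono[of "\<lambda>x. (F x)\<^sup>2" "\<lambda>_. C\<^sup>2"] \<open>bounded_fun F\<close> by (simp add: L_const)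
  then show ?thesis unfolding nrm_def using \<open>C \<ge> 0\<close> by (simp add: real_le_lsqrt)
qed

lemma nrm_sum:
  "(\<And>i. i \<in> I \<Longrightarrow> bounded_fun (F i)) \<Longrightarrow> nrm (\<lambda>x. \<Sum>i\<in>I. F i x) \<le> (\<Sum>i\<in>I. nrm (F i))"
proof (induction I rule: infinite_finite_induct)
  case (insert i I)
  then have "nrm (\<lambda>x. F i x + (\<Sum>i\<in>I. F i x)) \<le> nrm (F i) + nrm (\<lambda>x. \<Sum>i\<in>I. F i x)"
    by (intro nrm_add) auto
  then show ?case using insert by fastforce
qed (auto simp: nrm_def L_const)

lemma nrm_average:
  assumes "finite I" "I \<noteq> {}" "\<And>i. i \<in> I \<Longrightarrow> bounded_fun (F i)" "\<And>i. i \<in> I \<Longrightarrow> nrm (F i) \<le> C"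
  shows "nrm (\<lambda>x. (\<Sum>i\<in>I. F i x) / real (card I)) \<le> C"
proof -
  have "card I > 0" using assms by (simp add: card_gt_0_iff)
  have "nrm (\<lambda>x. \<Sum>i\<in>I. F i x) \<le> (\<Sum>i\<in>I. C)"
    using nrm_sum[of I F] assms sum_mono[of I "\<lambda>i. nrm (F i)" "\<lambda>_. C"] by fastforce
  then show ?thesis
    using assms \<open>card I > 0\<close> by (subst nrm_divide) (auto simp: field_simps)
qed

lemma nrm_perturb:
  assumes "bounded_fun F" "bounded_fun G" "nrm (\<lambda>x. F x - G x) \<le> C"
  shows "nrm F \<le> nrm G + C"
  using nrm_add[of G "\<lambda>x. F x - G x"] assms by simp

lemma L_le_nrm:
  assumes "bounded_fun F"
  shows "L F \<le> nrm F"
  using Cauchy_Schwarz[of F "\<lambda>_. 1"] assms by (simp add: nrm_def L_one)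

end

section \<open>Convex combinations of shifts\<close>

text \<open>Midpoint trees code convex combinations of shifts with dyadic weights. Midpoints are
  what the parallelogram law asks for, and trees allow induction. \<open>set_avg\<close> collects
  the shifts that occur.\<close>

datatype 'g avg = Sh 'g | Mid "'g avg" "'g avg"

primrec ev :: "'g::ab_group_add avg \<Rightarrow> ('g \<Rightarrow> real) \<Rightarrow> 'g \<Rightarrow> real" where
  "ev (Sh v) F = sh v F"
| "ev (Mid a b) F = (\<lambda>x. (ev a F x + ev b F x) / 2)"

primrec comp_avg :: "'g::ab_group_add avg \<Rightarrow> 'g avg \<Rightarrow> 'g avg" where
  "comp_avg (Sh v) d = map_avg ((+) v) d"
| "comp_avg (Mid a b) d = Mid (comp_avg a d) (comp_avg b d)"

text \<open>The adjoint for the form \<open>L (F * G)\<close>: under an invariant mean,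
  \<open>sh (- v)\<close> is adjoint to \<open>sh v\<close>.\<close>

definition adj :: "'g::ab_group_add avg \<Rightarrow> 'g avg" where
  "adj = map_avg uminus"

lemma bounded_fun_ev [simp, intro]: "bounded_fun F \<Longrightarrow> bounded_fun (ev a F)"
  by (induction a) auto

lemma ev_map_plus: "ev (map_avg ((+) v) d) F = sh v (ev d F)"
  by (induction d) (auto simp: sh_def fun_eq_iff ac_simps)

lemma ev_comp: "ev (comp_avg a d) F = ev a (ev d F)"
  by (induction a) (auto simp: ev_map_plus)

lemma ev_sh: "ev a (sh v F) = sh v (ev a F)"
  by (induction a) (auto simp: sh_def fun_eq_iff ac_simps)

lemma ev_diff: "ev a (\<lambda>x. F x - G x) x = ev a F x - ev a G x"
  by (induction a arbitrary: x) (auto simp: sh_def diff_divide_distrib add_divide_distrib)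

lemma ev_mono: "(\<And>x. F x \<le> G x) \<Longrightarrow> ev a F x \<le> ev a G x"
  by (induction a arbitrary: x) (auto simp: sh_def add_mono)

lemma ev_const: "ev a (\<lambda>_. c) x = c"
  by (induction a arbitrary: x) (auto simp: sh_def)

lemma set_comp_avg:
  "u \<in> set_avg (comp_avg a d) \<Longrightarrow> \<exists>v\<in>set_avg a. \<exists>w\<in>set_avg d. u = v + w"
  by (induction a) (auto simp: avg.set_map)

lemma set_comp_avg_subset:
  assumes "set_avg a \<subseteq> D" "set_avg d \<subseteq> D" "\<And>v w. v \<in> D \<Longrightarrow> w \<in> D \<Longrightarrow> v + w \<in> D"
  shows "set_avg (comp_avg a d) \<subseteq> D"
  using set_comp_avg[of _ a d] assms by blast

lemma set_adj: "set_avg (adj a) = uminus ` set_avg a"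
  by (simp add: adj_def avg.set_map)

section \<open>Averaging operators under the mean and their minimal energy\<close>

context inv_mean
begin

lemma L_sh_mult:
  assumes "bounded_fun F" "bounded_fun G"
  shows "L (\<lambda>x. sh v F x * G x) = L (\<lambda>x. F x * sh (- v) G x)"
proof -
  have "(\<lambda>x. sh v F x * G x) = sh v (\<lambda>x. F x * sh (- v) G x)"
    by (simp add: sh_def fun_eq_iff)
  then show ?thesis using L_shift[of "\<lambda>x. F x * sh (- v) G x" v] assms by auto
qed

lemma L_ev:
  assumes "bounded_fun F"
  shows "L (ev a F) = L F"
proof (induction a)
  case (Mid a b)
  then show ?case using assms L_divide[of "\<lambda>x. ev a F x + ev b F x" 2] by (simp add: L_add)
qed (simp add: L_shift assms)

lemma L_ev_mult:
  assumes "bounded_fun F" "bounded_fun G"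
  shows "L (\<lambda>x. ev a F x * G x) = L (\<lambda>x. F x * ev (adj a) G x)"
proof (induction a)
  case (Sh v)
  then show ?case using L_sh_mult[OF assms] by (simp add: adj_def)
next
  case (Mid a b)
  have "L (\<lambda>x. ev (Mid a b) F x * G x) = L (\<lambda>x. (ev a F x * G x + ev b F x * G x) / 2)"
    by (rule arg_cong[of _ _ L]) (auto simp: field_simps)
  also have "\<dots> = (L (\<lambda>x. ev a F x * G x) + L (\<lambda>x. ev b F x * G x)) / 2"
    using assms by (subst L_divide) (auto simp: L_add)
  also have "\<dots> = (L (\<lambda>x. F x * ev (adj a) G x) + L (\<lambda>x. F x * ev (adj b) G x)) / 2"
    using Mid by simp
  also have "\<dots> = L (\<lambda>x. (F x * ev (adj a) G x + F x * ev (adj b) G x) / 2)"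
    using assms by (subst L_divide) (auto simp: L_add)
  also have "\<dots> = L (\<lambda>x. F x * ev (adj (Mid a b)) G x)"
    by (rule arg_cong[of _ _ L]) (auto simp: field_simps adj_def)
  finally show ?case .
qed

lemma nrm_ev_le:
  assumes "bounded_fun F"
  shows "nrm (ev a F) \<le> nrm F"
proof (induction a)
  case (Mid a b)
  have "nrm (\<lambda>x. (ev a F x + ev b F x) / 2) \<le> (nrm (ev a F) + nrm (ev b F)) / 2"
    using nrm_add[of "ev a F" "ev b F"] assms by (subst nrm_divide) auto
  then show ?case using Mid by simp
qed (use assms in simp)

text \<open>The squared distance from 0 to the dyadic convex hull of the shifts of \<open>F\<close>
  by \<open>D\<close>. For a subgroup \<open>D\<close> it plays the role of the squared norm of the
  projection of \<open>F\<close> to the \<open>D\<close>-invariant functions. The infimum need not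
  be attained, so near minimisers stand in for the projection.\<close>

definition min_energy :: "'g set \<Rightarrow> ('g \<Rightarrow> real) \<Rightarrow> real" where
  "min_energy D F = (INF a \<in> {a. set_avg a \<subseteq> D}. (nrm (ev a F))\<^sup>2)"

lemma min_energy_le: "set_avg a \<subseteq> D \<Longrightarrow> min_energy D F \<le> (nrm (ev a F))\<^sup>2"
  unfolding min_energy_def by (rule cINF_lower) (auto intro: bdd_belowI2[of _ 0])

lemma min_energy_attained:
  assumes "0 \<in> D" "\<eta> > 0"
  obtains a where "set_avg a \<subseteq> D" "(nrm (ev a F))\<^sup>2 < min_energy D F + \<eta>"
proof -
  have ne: "{a. set_avg a \<subseteq> D} \<noteq> {}" using assms by (auto intro: exI[of _ "Sh 0"])
  have "\<exists>a\<in>{a. set_avg a \<subseteq> D}. (nrm (ev a F))\<^sup>2 < min_energy D F + \<eta>"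
    unfolding min_energy_def using assms ne
    by (subst cINF_less_iff[symmetric]) (auto intro: bdd_belowI2[of _ 0])
  then show ?thesis using that by blast
qed

text \<open>By the parallelogram law, as the midpoint of two elements of a convex set has at least the minimal energy.\<close>

lemma near_minimisers_close:
  assumes F: "bounded_fun F" and "set_avg a \<subseteq> D" "set_avg b \<subseteq> D"
    and "(nrm (ev a F))\<^sup>2 \<le> min_energy D F + \<eta>" "(nrm (ev b F))\<^sup>2 \<le> min_energy D F + \<eta>"
  shows "(nrm (\<lambda>x. ev a F x - ev b F x))\<^sup>2 \<le> 4 * \<eta>"
proof -
  have bd: "bounded_fun (ev a F)" "bounded_fun (ev b F)" using F by auto
  have "min_energy D F \<le> (nrm (ev (Mid a b) F))\<^sup>2"
    by (rule min_energy_le) (use assms in auto)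
  moreover have "nrm (ev (Mid a b) F) = nrm (\<lambda>x. ev a F x + ev b F x) / 2"
    using F by (simp add: nrm_divide)
  ultimately have "min_energy D F \<le> (nrm (\<lambda>x. ev a F x + ev b F x) / 2)\<^sup>2"
    by (simp only:)
  then have "min_energy D F \<le> (nrm (\<lambda>x. ev a F x + ev b F x))\<^sup>2 / 4"
    by (simp add: power_divide)
  moreover have "(nrm (\<lambda>x. ev a F x - ev b F x))\<^sup>2 + (nrm (\<lambda>x. ev a F x + ev b F x))\<^sup>2
      = 2 * (nrm (ev a F))\<^sup>2 + 2 * (nrm (ev b F))\<^sup>2"
    using L_square_add[OF bd, of 1] L_square_add[OF bd, of "- 1"] bd
    by (simp add: nrm_square)
  ultimately show ?thesis using assms(4,5) by linarith
qed

end

section \<open>Averages along linear and quadratic sequences\<close>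

text \<open>A shift by one replaces a single term, so the error grows with \<open>j\<close> but not
  with \<open>M\<close>.\<close>

lemma sum_shift_close:
  fixes b :: "nat \<Rightarrow> real"
  assumes "\<And>t. \<bar>b t\<bar> \<le> C"
  shows "\<bar>(\<Sum>t<M. b t) - (\<Sum>t<M. b (t + j))\<bar> \<le> 2 * real j * C"
proof (induction j)
  case (Suc j)
  have "(\<Sum>t<M. b (t + j)) - (\<Sum>t<M. b (t + Suc j)) = b j - b (M + j)"
    using sum_lessThan_telescope'[of "\<lambda>t. b (t + j)" M] by (simp add: sum_subtractf)
  moreover have "\<bar>b j - b (M + j)\<bar> \<le> 2 * C"
    using assms[of j] assms[of "M + j"] by linarith
  ultimately show ?case using Suc by (simp add: algebra_simps)
qed simp

text \<open>As \<open>e\<close> is a homomorphism, the shift by \<open>e (h * j)\<close> moves the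
  index \<open>t\<close> by \<open>j\<close>, so only boundary terms change. The bound is uniform in
  the base point \<open>x\<close>.\<close>

lemma av_shift_close:
  assumes e: "Modules.additive (e :: int \<Rightarrow> 'g::ab_group_add)" and F: "\<And>x. \<bar>F x\<bar> \<le> C"
  shows "\<bar>av {..<M} (\<lambda>t. e (h * int t)) F x - av {..<M} (\<lambda>t. e (h * int t)) (sh (e (h * j)) F) x\<bar>
           \<le> 2 * \<bar>real_of_int j\<bar> * C / real M"
proof -
  have nat_case: "\<bar>(\<Sum>t<M. F (y + e (h * int t))) - (\<Sum>t<M. F (y + e (h * int (t + i))))\<bar> \<le> 2 * real i * C"
    for y i using sum_shift_close[of "\<lambda>t. F (y + e (h * int t))" C M i] F by auto
  have "\<bar>(\<Sum>t<M. F (x + e (h * int t))) - (\<Sum>t<M. F (x + e (h * int t) + e (h * j)))\<bar>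
      \<le> 2 * \<bar>real_of_int j\<bar> * C"
  proof (cases "j \<ge> 0")
    case True
    then obtain i where "j = int i" by (metis nonneg_int_cases)
    then show ?thesis using nat_case[of x i]
      by (simp add: Modules.additive.add[OF e, symmetric] add.assoc distrib_left)
  next
    case False
    then obtain i where i: "j = - int i" by (metis int_cases2 of_nat_0_le_iff)
    have shift: "e (h * int (t + i)) = e (h * int t) + e (h * int i)" for t
      by (simp add: Modules.additive.add[OF e, symmetric] distrib_left)
    have neg: "e (h * j) = - e (h * int i)"
      by (simp add: i Modules.additive.minus[OF e])
    \<comment> \<open>For negative \<open>j\<close> the case of natural numbers is applied at the
      shifted base point, from where the shift goes forward.\<close>
    show ?thesis using nat_case[of "x + e (h * j)" i] i
      unfolding shift by (simp add: Modules.additive.minus[OF e] algebra_simps abs_minus_commute)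
  qed
  then show ?thesis
    by (simp add: av_def sh_def diff_divide_distrib[symmetric] abs_divide divide_right_mono)
qed

lemma av_ev_Mid:
  "av I u (ev (Mid a b) F) x = (av I u (ev a F) x + av I u (ev b F) x) / 2"
  by (simp add: av_def sum.distrib sum_divide_distrib[symmetric] add_divide_distrib)

text \<open>\<open>K\<close> depends on the tree \<open>a\<close> but neither on \<open>M\<close>
  nor on \<open>x\<close>: long averages along multiples of \<open>h\<close> absorb every averaging
  operator built from such shifts.\<close>

lemma av_ev_close:
  assumes e: "Modules.additive (e :: int \<Rightarrow> 'g::ab_group_add)" and F: "\<And>x. \<bar>F x\<bar> \<le> C"
  shows "set_avg a \<subseteq> range (\<lambda>j. e (h * j)) \<Longrightarrow>
    \<exists>K. \<forall>M x. \<bar>av {..<M} (\<lambda>t. e (h * int t)) F x - av {..<M} (\<lambda>t. e (h * int t)) (ev a F) x\<bar>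
           \<le> K / real M"
proof (induction a)
  case (Sh v)
  then obtain j where "v = e (h * j)" by auto
  then show ?case using av_shift_close[where F = F and C = C and h = h and j = j, OF e F] by auto
next
  case (Mid a b)
  let ?A = "\<lambda>M. av {..<M} (\<lambda>t. e (h * int t))"
  obtain K1 where K1: "\<And>M x. \<bar>?A M F x - ?A M (ev a F) x\<bar> \<le> K1 / real M"
    using Mid by auto
  obtain K2 where K2: "\<And>M x. \<bar>?A M F x - ?A M (ev b F) x\<bar> \<le> K2 / real M"
    using Mid by auto
  have "\<bar>?A M F x - ?A M (ev (Mid a b) F) x\<bar> \<le> ((K1 + K2) / 2) / real M" for M x
    using K1[of M x] K2[of M x] unfolding av_ev_Mid by (simp add: add_divide_distrib abs_if split: if_splits)
  then show ?case by blast
qed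

section \<open>Linear averages and the van der Corput inequality\<close>

context inv_mean
begin

lemma nrm_av_le:
  assumes "bounded_fun F"
  shows "nrm (av I u F) \<le> nrm F"
proof (cases "finite I \<and> I \<noteq> {}")
  case True
  then show ?thesis unfolding av_eq_sh using assms by (intro nrm_average) auto
next
  case False
  \<comment> \<open>Here \<open>card I = 0\<close>, and division by 0 gives 0.\<close>
  then have "av I u F = (\<lambda>_. 0)" by (auto simp: av_def fun_eq_iff)
  then show ?thesis using assms by (simp add: nrm_def L_const L_square_nonneg)
qed

text \<open>The mean ergodic theorem in the form needed: one convex combination of small norm
  controls all long averages, since these absorb \<open>a\<close> up to an error
  \<open>K / M\<close> and averaging does not increase \<open>nrm\<close>.\<close>

lemma eventually_nrm_av_le:
  assumes e: "Modules.additive (e :: int \<Rightarrow> 'g)" and F: "bounded_fun F"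
    and a: "set_avg a \<subseteq> range (\<lambda>j. e (h * j))" and "nrm (ev a F) \<le> \<rho>" "\<epsilon> > 0"
  shows "\<forall>\<^sub>F M in sequentially. nrm (av {..<M} (\<lambda>t. e (h * int t)) F) \<le> \<rho> + \<epsilon>"
proof -
  obtain C where C: "\<And>x. \<bar>F x\<bar> \<le> C" using bounded_funE[OF F] by blast
  let ?A = "\<lambda>M. av {..<M} (\<lambda>t. e (h * int t))"
  obtain K where K: "\<And>M x. \<bar>?A M F x - ?A M (ev a F) x\<bar> \<le> K / real M"
    using av_ev_close[where F = F and C = C, OF e C a] by blast
  have "nrm (?A M F) \<le> \<rho> + K / real M" for M
  proof -
    have "nrm (?A M F) \<le> nrm (?A M (ev a F)) + K / real M"
      using F K by (intro nrm_perturb nrm_le_const) auto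
    also have "nrm (?A M (ev a F)) \<le> nrm (ev a F)" using F by (intro nrm_av_le) auto
    finally show ?thesis using assms by linarith
  qed
  moreover have "\<forall>\<^sub>F M in sequentially. K / real M < \<epsilon>"
    using \<open>\<epsilon> > 0\<close> by real_asymp
  ultimately show ?thesis
    by (auto elim!: eventually_mono intro: order_trans[OF _ add_left_mono[OF less_imp_le]])
qed

text \<open>Averaging over \<open>R\<close> consecutive times and squaring leaves correlations of
  two shifted copies of \<open>G\<close>, which depend only on the difference of the shifts. The
  diagonal contributes \<open>1 / R\<close>. Off the diagonal the sum over \<open>t\<close> is an
  average along \<open>d i j\<close>, as the constant \<open>\<kappa> i j\<close> does not change
  norms. The last summand pays for boundary terms.\<close>

lemma van_der_Corput:
  assumes G: "\<And>x. \<bar>G x\<bar> \<le> 1" and "M > 0" "R > 0" "\<epsilon> \<ge> 0"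
    and diff: "\<And>i j t. i < R \<Longrightarrow> j < R \<Longrightarrow> i \<noteq> j \<Longrightarrow> u (t + i) - u (t + j) = \<kappa> i j + d i j t"
    and small: "\<And>i j. i < R \<Longrightarrow> j < R \<Longrightarrow> i \<noteq> j \<Longrightarrow> nrm (av {..<M} (d i j) G) \<le> \<epsilon>"
  shows "nrm (av {..<M} u G) \<le> sqrt (1 / real R + \<epsilon>) + 2 * real R / real M"
proof -
  have bG [simp]: "bounded_fun G" using G by (rule bounded_funI)
  define W where "W t = (\<lambda>x. (\<Sum>i<R. sh (u (t + i)) G x) / real R)" for t
  define A where "A = (\<lambda>x. (\<Sum>t<M. W t x) / real M)"
  have bW [simp]: "bounded_fun (W t)" for t unfolding W_def by auto
  have bA [simp]: "bounded_fun A" unfolding A_def by auto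
  have corr: "L (\<lambda>x. \<Sum>t<M. sh (u (t + i)) G x * sh (u (t + j)) G x)
      \<le> real M * (if i = j then 1 else \<epsilon>)" if "i < R" "j < R" for i j
  proof (cases "i = j")
    case True
    have "(G x)\<^sup>2 \<le> 1" for x using G by (simp add: abs_square_le_1)
    then have "(\<Sum>t<M. sh (u (t + i)) G x * sh (u (t + j)) G x) \<le> (\<Sum>t<M. 1)" for x
      using True by (intro sum_mono) (simp add: sh_def power2_eq_square)
    then have "L (\<lambda>x. \<Sum>t<M. sh (u (t + i)) G x * sh (u (t + j)) G x) \<le> L (\<lambda>x. real M)"
      by (intro L_mono) auto
    then show ?thesis using True by (simp add: L_const)
  next
    case False
    have "L (\<lambda>x. sh (u (t + i)) G x * sh (u (t + j)) G x) = L (\<lambda>x. sh (\<kappa> i j + d i j t) G x * G x)" for t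
    proof -
      have "L (\<lambda>x. sh (u (t + i)) G x * sh (u (t + j)) G x)
          = L (\<lambda>x. sh (u (t + j)) G x * sh (u (t + i)) G x)"
        by (simp add: mult.commute)
      also have "\<dots> = L (\<lambda>x. G x * sh (- u (t + j)) (sh (u (t + i)) G) x)"
        by (rule L_sh_mult) auto
      also have "\<dots> = L (\<lambda>x. sh (\<kappa> i j + d i j t) G x * G x)"
        using diff[OF that False, of t] by (simp add: sh_sh mult.commute)
      finally show ?thesis .
    qed
    then have "L (\<lambda>x. \<Sum>t<M. sh (u (t + i)) G x * sh (u (t + j)) G x)
        = (\<Sum>t<M. L (\<lambda>x. sh (\<kappa> i j + d i j t) G x * G x))"
      by (subst L_sum) auto
    also have "\<dots> = L (\<lambda>x. \<Sum>t<M. sh (\<kappa> i j + d i j t) G x * G x)"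
      by (subst L_sum) auto
    also have "\<dots> = L (\<lambda>x. real M * (sh (\<kappa> i j) (av {..<M} (d i j) G) x * G x))"
      using \<open>M > 0\<close> by (simp add: sh_def av_def sum_distrib_right add.assoc)
    also have "\<dots> = real M * L (\<lambda>x. sh (\<kappa> i j) (av {..<M} (d i j) G) x * G x)"
      by (rule L_scale) auto
    also have "\<dots> \<le> real M * \<epsilon>"
    proof (rule mult_left_mono)
      have "L (\<lambda>x. sh (\<kappa> i j) (av {..<M} (d i j) G) x * G x)
          \<le> nrm (sh (\<kappa> i j) (av {..<M} (d i j) G)) * nrm G"
        using Cauchy_Schwarz[of "sh (\<kappa> i j) (av {..<M} (d i j) G)" G] by simp
      also have "\<dots> \<le> \<epsilon> * 1"
        using small[OF that False] \<open>\<epsilon> \<ge> 0\<close> nrm_le_const[OF G] by (intro mult_mono) auto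
      finally show "L (\<lambda>x. sh (\<kappa> i j) (av {..<M} (d i j) G) x * G x) \<le> \<epsilon>" by simp
    qed simp
    finally show ?thesis using False by simp
  qed
  have "L (\<lambda>x. (A x)\<^sup>2) \<le> L (\<lambda>x. (\<Sum>t<M. (W t x)\<^sup>2) / real M)"
  proof (intro L_mono)
    fix x
    have "(\<Sum>t<M. W t x)\<^sup>2 \<le> real M * (\<Sum>t<M. (W t x)\<^sup>2)"
      using sum_squared_le_sum_of_squares[of "\<lambda>t. W t x" "{..<M}"] by (simp add: mult.commute)
    then show "(A x)\<^sup>2 \<le> (\<Sum>t<M. (W t x)\<^sup>2) / real M"
      using \<open>M > 0\<close> by (simp add: A_def power_divide power2_eq_square field_simps)
  qed auto
  also have "\<dots> = L (\<lambda>x. (\<Sum>i<R. \<Sum>j<R. \<Sum>t<M. sh (u (t + i)) G x * sh (u (t + j)) G x)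
                       / (real M * (real R)\<^sup>2))"
  proof (rule arg_cong[of _ _ L], rule ext)
    fix x
    have "(\<Sum>t<M. (W t x)\<^sup>2) = (\<Sum>t<M. \<Sum>i<R. \<Sum>j<R. sh (u (t + i)) G x * sh (u (t + j)) G x) / (real R)\<^sup>2"
      by (simp add: W_def power_divide power2_eq_square sum_product sum_divide_distrib)
    also have "(\<Sum>t<M. \<Sum>i<R. \<Sum>j<R. sh (u (t + i)) G x * sh (u (t + j)) G x)
        = (\<Sum>i<R. \<Sum>j<R. \<Sum>t<M. sh (u (t + i)) G x * sh (u (t + j)) G x)"
      by (subst sum.swap, rule sum.cong[OF refl], rule sum.swap)
    finally show "(\<Sum>t<M. (W t x)\<^sup>2) / real M = (\<Sum>i<R. \<Sum>j<R. \<Sum>t<M. sh (u (t + i)) G x * sh (u (t + j)) G x)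
                       / (real M * (real R)\<^sup>2)"
      by (simp add: mult.commute)
  qed
  also have "\<dots> = (\<Sum>i<R. \<Sum>j<R. L (\<lambda>x. \<Sum>t<M. sh (u (t + i)) G x * sh (u (t + j)) G x))
                       / (real M * (real R)\<^sup>2)"
    by (subst L_divide; (subst L_sum)?; (subst L_sum)?; (intro bounded_fun_sum bounded_fun_mult)?; simp)
  also have "\<dots> \<le> (\<Sum>i<R. \<Sum>j<R. real M * (if i = j then 1 else 0) + real M * \<epsilon>)
                       / (real M * (real R)\<^sup>2)"
  proof (intro divide_right_mono sum_mono)
    fix i j assume "i \<in> {..<R}" "j \<in> {..<R}"
    then show "L (\<lambda>x. \<Sum>t<M. sh (u (t + i)) G x * sh (u (t + j)) G x)
        \<le> real M * (if i = j then 1 else 0) + real M * \<epsilon>"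
      using corr[of i j] \<open>\<epsilon> \<ge> 0\<close> by (auto split: if_splits intro: order_trans)
  qed simp
  also have "\<dots> = 1 / real R + \<epsilon>"
    using \<open>M > 0\<close> \<open>R > 0\<close>
    by (simp add: sum.distrib sum_distrib_left[symmetric] field_simps power2_eq_square)
  finally have "nrm A \<le> sqrt (1 / real R + \<epsilon>)" by (simp add: nrm_def)
  moreover have "\<bar>av {..<M} u G x - A x\<bar> \<le> 2 * real R / real M" for x
  proof -
    have "A x = (\<Sum>t<M. \<Sum>i<R. G (x + u (t + i))) / (real R * real M)"
      by (simp add: A_def W_def sh_def sum_divide_distrib[symmetric])
    also have "\<dots> = (\<Sum>i<R. \<Sum>t<M. G (x + u (t + i))) / (real R * real M)"
      by (subst sum.swap) simp
    finally have "av {..<M} u G x - A x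
        = (\<Sum>i<R. (\<Sum>t<M. G (x + u t)) - (\<Sum>t<M. G (x + u (t + i)))) / (real R * real M)"
      using \<open>R > 0\<close> by (simp add: av_def sum_subtractf diff_divide_distrib)
    also have "\<bar>\<dots>\<bar> \<le> (\<Sum>i<R. 2 * real R) / (real R * real M)"
    proof -
      have "\<bar>(\<Sum>t<M. G (x + u t)) - (\<Sum>t<M. G (x + u (t + i)))\<bar> \<le> 2 * real R" if "i < R" for i
        using sum_shift_close[of "\<lambda>t. G (x + u t)" 1 M i] G that by fastforce
      then have "\<bar>\<Sum>i<R. (\<Sum>t<M. G (x + u t)) - (\<Sum>t<M. G (x + u (t + i)))\<bar> \<le> (\<Sum>i<R. 2 * real R)"
        by (intro order_trans[OF sum_abs] sum_mono) auto
      then have "\<bar>\<Sum>i<R. (\<Sum>t<M. G (x + u t)) - (\<Sum>t<M. G (x + u (t + i)))\<bar> / (real R * real M)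
          \<le> (\<Sum>i<R. 2 * real R) / (real R * real M)"
        by (rule divide_right_mono) simp
      then show ?thesis by (simp only: abs_divide abs_of_nonneg of_nat_0_le_iff zero_le_mult_iff) simp
    qed
    also have "\<dots> = 2 * real R / real M" using \<open>R > 0\<close> by (simp add: field_simps)
    finally show ?thesis .
  qed
  then have "nrm (\<lambda>x. av {..<M} u G x - A x) \<le> 2 * real R / real M" by (rule nrm_le_const)
  ultimately show ?thesis
    using nrm_perturb[of "av {..<M} u G" A] by fastforce
qed

end

section \<open>Almost invariant parts and quadratic averages of the rest\<close>

lemma range_multiples_abs:
  fixes e :: "int \<Rightarrow> 'a"
  shows "range (\<lambda>j. e (\<bar>h\<bar> * j)) = range (\<lambda>j. e (h * j))"
proof (cases "h \<ge> 0")
  case False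
  have "(\<lambda>j. e (\<bar>h\<bar> * j)) = (\<lambda>j. e (h * j)) \<circ> uminus" using False by (auto simp: fun_eq_iff)
  then show ?thesis by (metis fun.set_map surj_uminus)
qed simp

lemma range_multiples_subset:
  fixes e :: "int \<Rightarrow> 'a"
  assumes "H dvd h"
  shows "range (\<lambda>j. e (h * j)) \<subseteq> range (\<lambda>j. e (H * j))"
  using assms by (auto elim!: dvdE simp: mult.assoc)

context inv_mean
begin

text \<open>\<open>H\<close> almost attains the supremum of the energies over all nonzero
  \<open>h\<close>, which is at most 1. Passing from multiples of \<open>H\<close> to any sparser
  subgroup then raises the energy by less than \<open>\<eta>\<close>, so finer periods of
  \<open>F\<close> are negligible.\<close>

lemma energy_stabilises:
  fixes e :: "int \<Rightarrow> 'g"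
  assumes e: "Modules.additive e" and F: "\<And>x. \<bar>F x\<bar> \<le> 1" and "\<eta> > 0"
  obtains H where "H > 0"
    "\<And>h. h \<noteq> 0 \<Longrightarrow> min_energy (range (\<lambda>j. e (h * j))) F < min_energy (range (\<lambda>j. e (H * j))) F + \<eta>"
proof -
  let ?\<phi> = "\<lambda>h. min_energy (range (\<lambda>j. e (h * j))) F"
  have "?\<phi> h \<le> 1" for h
  proof -
    have "0 \<in> range (\<lambda>j. e (h * j))"
      by (rule range_eqI[of _ _ 0]) (simp add: Modules.additive.zero[OF e])
    then have "?\<phi> h \<le> (nrm (ev (Sh 0) F))\<^sup>2" by (intro min_energy_le) simp
    also have "\<dots> \<le> 1"
      using nrm_le_const[OF F] nrm_nonneg[OF bounded_funI[OF F]] by (simp add: power_le_one)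
    finally show ?thesis .
  qed
  then have bdd: "bdd_above (?\<phi> ` {h. h \<noteq> 0})" by (auto intro: bdd_aboveI2[where M = 1])
  have "(SUP h\<in>{h. h \<noteq> 0}. ?\<phi> h) - \<eta> < (SUP h\<in>{h. h \<noteq> 0}. ?\<phi> h)" using \<open>\<eta> > 0\<close> by simp
  then obtain H where H: "H \<noteq> 0" "(SUP h\<in>{h. h \<noteq> 0}. ?\<phi> h) - \<eta> < ?\<phi> H"
    by (subst (asm) less_cSUP_iff) (auto simp: bdd intro: exI[of _ 1])
  have "?\<phi> h < ?\<phi> \<bar>H\<bar> + \<eta>" if "h \<noteq> 0" for h
    using cSUP_upper[OF _ bdd, of h] that H by (simp add: range_multiples_abs)
  then show ?thesis using that[of "\<bar>H\<bar>"] H by auto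
qed

text \<open>A near minimiser over the multiples of \<open>H\<close> is nearly invariant under them,
  as its shifts are near minimisers too. The rest nearly averages out along multiples of
  \<open>H\<close> because the energy hardly grows any more. The form
  \<open>ev (adj a) (ev a F)\<close> is chosen so that correlations become squares in
  \<open>nrm_av_ev_square\<close>.\<close>

lemma invariant_approximant:
  fixes e :: "int \<Rightarrow> 'g"
  assumes e: "Modules.additive e" and F: "\<And>x. \<bar>F x\<bar> \<le> 1" and "\<rho> > 0"
  obtains H a where "H > 0"
    "\<And>j. nrm (\<lambda>x. sh (e (H * j)) (ev (adj a) (ev a F)) x - ev (adj a) (ev a F) x) \<le> \<rho>"
    "\<And>h \<epsilon>. h \<noteq> 0 \<Longrightarrow> H dvd h \<Longrightarrow> \<epsilon> > 0 \<Longrightarrow> \<forall>\<^sub>F M in sequentially.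
       nrm (av {..<M} (\<lambda>t. e (h * int t)) (\<lambda>x. F x - ev (adj a) (ev a F) x)) \<le> \<rho> + \<epsilon>"
proof -
  \<comment> \<open>Two near minimisers with slack \<open>2 * \<eta>\<close> are then
    \<open>\<rho>\<close>-close, as \<open>4 * (2 * \<eta>) = \<rho>^2\<close>.\<close>
  define \<eta> where "\<eta> = \<rho>\<^sup>2 / 8"
  define D where "D h = range (\<lambda>j. e (h * j))" for h
  have \<eta>: "\<eta> > 0" using \<open>\<rho> > 0\<close> by (simp add: \<eta>_def)
  have [simp]: "bounded_fun F" using F by (rule bounded_funI)
  have D_0: "0 \<in> D h" for h
    unfolding D_def by (rule range_eqI[of _ _ 0]) (simp add: Modules.additive.zero[OF e])
  have D_add: "v + w \<in> D h" if "v \<in> D h" "w \<in> D h" for v w h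
    using that unfolding D_def by (auto simp: Modules.additive.add[OF e, symmetric] distrib_left[symmetric])
  have D_minus: "- v \<in> D h" if "v \<in> D h" for v h
    using that unfolding D_def
    by (auto simp: Modules.additive.minus[OF e, symmetric] mult_minus_right[symmetric] simp del: mult_minus_right)
  obtain H where "H > 0" and H: "\<And>h. h \<noteq> 0 \<Longrightarrow> min_energy (D h) F < min_energy (D H) F + \<eta>"
    using energy_stabilises[where F = F, OF e F \<eta>] unfolding D_def by blast
  obtain a where a: "set_avg a \<subseteq> D H" "(nrm (ev a F))\<^sup>2 < min_energy (D H) F + \<eta>"
    using min_energy_attained[OF D_0 \<eta>] .
  define c where "c = comp_avg (adj a) a"
  have g: "ev (adj a) (ev a F) = ev c F" by (simp add: c_def ev_comp)
  have c: "set_avg c \<subseteq> D H" unfolding c_def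
    by (rule set_comp_avg_subset) (use a D_add D_minus in \<open>auto simp: set_adj\<close>)
  have "nrm (ev c F) \<le> nrm (ev a F)" by (simp add: g[symmetric] nrm_ev_le)
  then have "(nrm (ev c F))\<^sup>2 \<le> (nrm (ev a F))\<^sup>2" by (simp add: power_mono)
  then have c_min: "(nrm (ev c F))\<^sup>2 \<le> min_energy (D H) F + 2 * \<eta>" using a \<eta> by linarith
  have close: "nrm (\<lambda>x. ev b F x - ev b' F x) \<le> \<rho>"
    if "set_avg b \<subseteq> D H" "set_avg b' \<subseteq> D H" "(nrm (ev b F))\<^sup>2 \<le> min_energy (D H) F + 2 * \<eta>"
      "(nrm (ev b' F))\<^sup>2 \<le> min_energy (D H) F + 2 * \<eta>" for b b'
  proof (rule power2_le_imp_le)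
    show "(nrm (\<lambda>x. ev b F x - ev b' F x))\<^sup>2 \<le> \<rho>\<^sup>2"
      using near_minimisers_close[OF _ that] by (simp add: \<eta>_def)
  qed (use \<open>\<rho> > 0\<close> in simp)
  have inv: "nrm (\<lambda>x. sh (e (H * j)) (ev c F) x - ev c F x) \<le> \<rho>" for j
  proof -
    have "set_avg (comp_avg (Sh (e (H * j))) c) \<subseteq> D H"
      using c D_add by (intro set_comp_avg_subset) (auto simp: D_def)
    then have "nrm (\<lambda>x. ev (comp_avg (Sh (e (H * j))) c) F x - ev c F x) \<le> \<rho>"
      by (rule close) (use c c_min in \<open>auto simp: ev_map_plus\<close>)
    then show ?thesis by (simp add: ev_map_plus)
  qed
  have kill: "\<forall>\<^sub>F M in sequentially. nrm (av {..<M} (\<lambda>t. e (h * int t)) (\<lambda>x. F x - ev c F x)) \<le> \<rho> + \<epsilon>"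
    if "h \<noteq> 0" "H dvd h" "\<epsilon> > 0" for h \<epsilon>
  proof -
    obtain b where b: "set_avg b \<subseteq> D h" "(nrm (ev b F))\<^sup>2 < min_energy (D h) F + \<eta>"
      using min_energy_attained[OF D_0 \<eta>] .
    have b': "set_avg b \<subseteq> D H"
      using b(1) range_multiples_subset[OF that(2), of e] unfolding D_def by blast
    have bc: "set_avg (comp_avg b c) \<subseteq> D H"
      using b' c D_add by (rule set_comp_avg_subset)
    have "nrm (ev (comp_avg b c) F) \<le> nrm (ev c F)" by (simp add: ev_comp nrm_ev_le)
    then have sq: "(nrm (ev (comp_avg b c) F))\<^sup>2 \<le> (nrm (ev c F))\<^sup>2" by (simp add: power_mono)
    \<comment> \<open>By the choice of \<open>H\<close>, \<open>b\<close> is nearly minimal over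
      \<open>D H\<close> as well. So is its composition with \<open>c\<close>, because
      \<open>ev b\<close> does not increase norms. Hence \<open>ev b\<close> nearly annihilates
      \<open>F - ev c F\<close>.\<close>
    have "nrm (\<lambda>x. ev b F x - ev (comp_avg b c) F x) \<le> \<rho>"
      using b b' bc c_min sq H[OF that(1)] by (intro close) linarith+
    moreover have "ev b (\<lambda>x. F x - ev c F x) = (\<lambda>x. ev b F x - ev (comp_avg b c) F x)"
      by (simp add: ev_diff ev_comp fun_eq_iff)
    ultimately show ?thesis
      using that b by (intro eventually_nrm_av_le[OF e, of _ b]) (auto simp: D_def)
  qed
  show ?thesis using that[of H a] \<open>H > 0\<close> inv kill unfolding g by blast
qed

text \<open>\<open>(t + i)^2 - (t + j)^2\<close> is linear in \<open>t\<close> with slope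
  \<open>2 * (i - j)\<close>, so the van der Corput inequality leads to linear averages whose steps
  are nonzero multiples of \<open>r\<close>. A homomorphism \<open>y\<close> adds only a constant to
  the differences; thus one \<open>M\<close> serves all \<open>v\<close> and
  \<open>y\<close>.\<close>

lemma quadratic_average_small:
  fixes e :: "int \<Rightarrow> 'g"
  assumes e: "Modules.additive e" and G: "\<And>x. \<bar>G x\<bar> \<le> 1" and "r \<noteq> 0" "\<rho> \<ge> 0" "\<epsilon> > 0"
    and small: "\<And>h \<epsilon>. h \<noteq> 0 \<Longrightarrow> r dvd h \<Longrightarrow> \<epsilon> > 0 \<Longrightarrow> \<forall>\<^sub>F M in sequentially.
       nrm (av {..<M} (\<lambda>t. e (h * int t)) G) \<le> \<rho> + \<epsilon>"
  shows "\<forall>\<^sub>F M in sequentially. \<forall>v y. Modules.additive y \<longrightarrow>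
           nrm (av {..<M} (\<lambda>t. v + y (int t) + e (r * (int t)\<^sup>2)) G) \<le> sqrt (\<rho> + \<epsilon>) + \<epsilon>"
proof -
  \<comment> \<open>\<open>1 / R\<close> takes one half of \<open>\<epsilon>\<close>, the linear
    averages the other.\<close>
  obtain R :: nat where "R > 0" and R: "1 / real R < \<epsilon> / 2"
    using real_arch_inverse[of "\<epsilon> / 2"] \<open>\<epsilon> > 0\<close> by (auto simp: inverse_eq_divide)
  define d where "d i j t = e ((2 * r * (int i - int j)) * int t)" for i j t :: nat
  have ev1: "\<forall>\<^sub>F M in sequentially. \<forall>i\<in>{..<R}. \<forall>j\<in>{..<R}. i \<noteq> j \<longrightarrow>
      nrm (av {..<M} (d i j) G) \<le> \<rho> + \<epsilon> / 2"
    unfolding d_def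
  proof (intro eventually_ball_finite ballI)
    fix i j assume "i \<in> {..<R}" "j \<in> {..<R}"
    show "\<forall>\<^sub>F M in sequentially. i \<noteq> j \<longrightarrow>
        nrm (av {..<M} (\<lambda>t. e ((2 * r * (int i - int j)) * int t)) G) \<le> \<rho> + \<epsilon> / 2"
    proof (cases "i = j")
      case False
      then have "\<forall>\<^sub>F M in sequentially.
          nrm (av {..<M} (\<lambda>t. e ((2 * r * (int i - int j)) * int t)) G) \<le> \<rho> + \<epsilon> / 2"
        using \<open>r \<noteq> 0\<close> \<open>\<epsilon> > 0\<close> by (intro small) auto
      then show ?thesis by eventually_elim simp
    qed simp
  qed auto
  have ev2: "\<forall>\<^sub>F M in sequentially. 2 * real R / real M < \<epsilon>"
    using \<open>\<epsilon> > 0\<close> by real_asymp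
  from ev1 ev2 eventually_gt_at_top[of 0] show ?thesis
  proof eventually_elim
    case (elim M)
    show ?case
    proof (intro allI impI)
      fix v and y :: "int \<Rightarrow> 'g"
      assume y: "Modules.additive y"
      define u where "u t = v + y (int t) + e (r * (int t)\<^sup>2)" for t
      have "nrm (av {..<M} u G) \<le> sqrt (1 / real R + (\<rho> + \<epsilon> / 2)) + 2 * real R / real M"
      proof (rule van_der_Corput[OF G, where d = d
            and \<kappa> = "\<lambda>i j. y (int i - int j) + e (r * ((int i)\<^sup>2 - (int j)\<^sup>2))"])
        fix i j t :: nat
        have "r * (int (t + i))\<^sup>2 = r * (int (t + j))\<^sup>2 + r * ((int i)\<^sup>2 - (int j)\<^sup>2)
            + (2 * r * (int i - int j)) * int t"
          by (simp add: power2_eq_square algebra_simps)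
        then have "e (r * (int (t + i))\<^sup>2) = e (r * (int (t + j))\<^sup>2) + e (r * ((int i)\<^sup>2 - (int j)\<^sup>2)) + d i j t"
          unfolding d_def by (simp only: Modules.additive.add[OF e])
        moreover have "y (int (t + i)) = y (int (t + j)) + y (int i - int j)"
          by (simp add: Modules.additive.add[OF y, symmetric])
        ultimately show "u (t + i) - u (t + j) = y (int i - int j) + e (r * ((int i)\<^sup>2 - (int j)\<^sup>2)) + d i j t"
          unfolding u_def by (simp add: algebra_simps)
      qed (use elim \<open>R > 0\<close> \<open>\<rho> \<ge> 0\<close> \<open>\<epsilon> > 0\<close> in auto)
      also have "\<dots> \<le> sqrt (\<rho> + \<epsilon>) + \<epsilon>"
        using R elim by (intro add_mono) auto
      finally show "nrm (av {..<M} (\<lambda>t. v + y (int t) + e (r * (int t)\<^sup>2)) G) \<le> sqrt (\<rho> + \<epsilon>) + \<epsilon>"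
        unfolding u_def .
    qed
  qed
qed

text \<open>Expanding the square and moving one \<open>ev a\<close> across by its adjoint:
  correlations of \<open>z\<close> with \<open>ev (adj a) (ev a z)\<close>, averaged over all
  differences of shifts, form a square and so admit a lower bound.\<close>

lemma nrm_av_ev_square:
  assumes "bounded_fun z"
  shows "(nrm (av I u (ev a z)))\<^sup>2
    = (\<Sum>\<beta>\<in>I. \<Sum>\<alpha>\<in>I. L (\<lambda>x. z x * sh (u \<alpha> - u \<beta>) (ev (adj a) (ev a z)) x)) / (real (card I))\<^sup>2"
proof (cases "finite I")
  case True
  have corr: "L (\<lambda>x. sh (u \<beta>) (ev a z) x * sh (u \<alpha>) (ev a z) x)
      = L (\<lambda>x. z x * sh (u \<alpha> - u \<beta>) (ev (adj a) (ev a z)) x)" for \<alpha> \<beta>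
  proof -
    have "L (\<lambda>x. sh (u \<beta>) (ev a z) x * sh (u \<alpha>) (ev a z) x)
        = L (\<lambda>x. ev a z x * sh (- u \<beta>) (sh (u \<alpha>) (ev a z)) x)"
      using assms by (intro L_sh_mult) auto
    also have "\<dots> = L (\<lambda>x. z x * ev (adj a) (sh (- u \<beta>) (sh (u \<alpha>) (ev a z))) x)"
      using assms by (intro L_ev_mult) auto
    finally show ?thesis by (simp add: sh_sh ev_sh)
  qed
  have "(nrm (av I u (ev a z)))\<^sup>2 = L (\<lambda>x. (av I u (ev a z) x)\<^sup>2)"
    using assms by (simp add: nrm_square)
  also have "\<dots> = L (\<lambda>x. (\<Sum>\<beta>\<in>I. \<Sum>\<alpha>\<in>I. sh (u \<beta>) (ev a z) x * sh (u \<alpha>) (ev a z) x) / (real (card I))\<^sup>2)"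
    by (rule arg_cong[of _ _ L]) (simp add: av_eq_sh power_divide power2_eq_square sum_product)
  also have "\<dots> = (\<Sum>\<beta>\<in>I. \<Sum>\<alpha>\<in>I. L (\<lambda>x. sh (u \<beta>) (ev a z) x * sh (u \<alpha>) (ev a z) x)) / (real (card I))\<^sup>2"
    using True assms
    by (subst L_divide; (subst L_sum)?; (subst L_sum)?; (intro bounded_fun_sum bounded_fun_mult)?; simp)
  finally show ?thesis by (simp add: corr)
next
  case False
  then have "av I u (ev a z) = (\<lambda>_. 0)" by (auto simp: av_def fun_eq_iff)
  then show ?thesis using False by (simp add: nrm_def L_const)
qed

end

section \<open>Quadratic returns\<close>

lemma int_dvd_fact:
  fixes s :: int
  assumes "s \<noteq> 0" "\<bar>s\<bar> \<le> int S"
  shows "s dvd fact S"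
proof -
  have "nat \<bar>s\<bar> dvd fact S" using assms by (intro dvd_fact) auto
  then have "int (nat \<bar>s\<bar>) dvd int (fact S)" by (simp only: of_nat_dvd_iff)
  then show ?thesis by simp
qed

context inv_mean
begin

text \<open>Correlations of \<open>z = indicator Z\<close> over differences of the shifts
  \<open>u (t, i)\<close>, built from \<open>x\<close> and \<open>p\<close>, average to a square
  that is at least \<open>(L z)^2\<close>. Pairs with equal \<open>i\<close> contribute at most
  \<open>1 / S\<close>. For the others, with \<open>s = i - j\<close>, adding the term along
  \<open>e\<close> hardly changes the average of \<open>g\<close> and leads to shifts that carry
  \<open>Z\<close> off \<open>B\<close>. The bound does not involve \<open>f\<close>.\<close>

lemma bad_set_bound:
  fixes x p e :: "int \<Rightarrow> 'g" and f H k :: int and B Z :: "'g set" and a :: "'g avg" and S :: nat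
  assumes hom: "Modules.additive x" "Modules.additive p" "Modules.additive e"
    and "H > 0" "S > 0" "\<rho> > 0"
  defines "F \<equiv> indicator B"
  defines "g \<equiv> ev (adj a) (ev a F)"
  defines "r \<equiv> \<lambda>s. H * ((fact S)\<^sup>2 div s)"
  assumes inv: "\<And>j. nrm (\<lambda>x. sh (e (H * j)) g x - g x) \<le> \<rho>"
    and kill: "\<And>h \<epsilon>. h \<noteq> 0 \<Longrightarrow> H dvd h \<Longrightarrow> \<epsilon> > 0 \<Longrightarrow> \<forall>\<^sub>F M in sequentially.
       nrm (av {..<M} (\<lambda>t. e (h * int t)) (\<lambda>x. F x - g x)) \<le> \<rho> + \<epsilon>"
    and "Z \<subseteq> B"
    and avoid: "\<And>b s t. b \<in> Z \<Longrightarrow> s \<noteq> 0 \<Longrightarrow> \<bar>s\<bar> < int S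
      \<Longrightarrow> b + (x (k * t) + p (H * s) + e (r s * (f - t\<^sup>2))) \<notin> B"
  shows "(L (indicator Z))\<^sup>2 \<le> 1 / real S + (sqrt (2 * \<rho>) + 2 * \<rho>)"
proof -
  define z :: "'g \<Rightarrow> real" where "z = indicator Z"
  define h where "h = ev (adj a) (ev a z)"
  define G where "G = (\<lambda>x. F x - g x)"
  define \<sigma> where "\<sigma> = sqrt (2 * \<rho>) + 2 * \<rho>"
  have F01: "0 \<le> F y" "F y \<le> 1" for y by (auto simp: F_def indicator_def)
  have g01: "0 \<le> g y" "g y \<le> 1" for y
    using ev_mono[of "\<lambda>_. 0" "ev a F" "adj a" y] ev_mono[of "ev a F" "\<lambda>_. 1" "adj a" y]
      ev_mono[of "\<lambda>_. 0" F a] ev_mono[of F "\<lambda>_. 1" a] F01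
    by (auto simp: g_def ev_const)
  have z01: "0 \<le> z y" "z y \<le> 1" "z y \<le> F y" for y
    using \<open>Z \<subseteq> B\<close> by (auto simp: z_def F_def indicator_def)
  have h_le_g: "h y \<le> g y" for y unfolding h_def g_def by (intro ev_mono z01)
  have bd [simp]: "bounded_fun F" "bounded_fun z" by (simp_all add: F_def z_def)
  then have bd' [simp]: "bounded_fun g" "bounded_fun h" "bounded_fun G"
    unfolding g_def h_def G_def by auto
  have G1: "\<bar>G y\<bar> \<le> 1" for y using F01[of y] g01[of y] by (auto simp: G_def)
  have r: "r s \<noteq> 0" "H dvd r s" if "s \<noteq> 0" "\<bar>s\<bar> < int S" for s
  proof -
    have "s dvd (fact S)\<^sup>2" using int_dvd_fact[of s S] that by (simp add: power2_eq_square)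
    then have "(fact S)\<^sup>2 div s * s = (fact S)\<^sup>2" by simp
    moreover have "(fact S)\<^sup>2 \<noteq> (0::int)" by simp
    ultimately have "(fact S)\<^sup>2 div s \<noteq> 0" by (metis mult_zero_left)
    then show "r s \<noteq> 0" "H dvd r s" using \<open>H > 0\<close> by (auto simp: r_def)
  qed
  \<comment> \<open>The coefficient of \<open>t^2\<close> along \<open>e\<close> is
    \<open>- r s\<close>, a nonzero multiple of \<open>H\<close>. Finitely many \<open>s\<close>
    occur, so one \<open>M\<close> works for all of them, uniformly in \<open>v\<close> and
    \<open>y\<close>, which later depend on \<open>t'\<close>.\<close>
  have "\<forall>\<^sub>F M in sequentially. \<forall>s\<in>{- int S<..<int S} - {0}. \<forall>v y. Modules.additive y \<longrightarrow>
           nrm (av {..<M} (\<lambda>t. v + y (int t) + e (- r s * (int t)\<^sup>2)) G) \<le> sqrt (\<rho> + \<rho>) + \<rho>"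
  proof (intro eventually_ball_finite ballI)
    fix s assume s: "s \<in> {- int S<..<int S} - {0}"
    then have rs: "r s \<noteq> 0" "H dvd r s" using r[of s] by (auto simp: abs_less_iff)
    show "\<forall>\<^sub>F M in sequentially. \<forall>v y. Modules.additive y \<longrightarrow>
           nrm (av {..<M} (\<lambda>t. v + y (int t) + e (- r s * (int t)\<^sup>2)) G) \<le> sqrt (\<rho> + \<rho>) + \<rho>"
    proof (rule quadratic_average_small[OF hom(3) G1])
      fix h' \<epsilon> assume "h' \<noteq> 0" "- r s dvd h'" "(\<epsilon>::real) > 0"
      then show "\<forall>\<^sub>F M in sequentially. nrm (av {..<M} (\<lambda>t. e (h' * int t)) G) \<le> \<rho> + \<epsilon>"
        unfolding G_def using rs by (intro kill) (auto intro: dvd_trans)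
    qed (use rs \<open>\<rho> > 0\<close> in auto)
  qed auto
  from eventually_conj[OF this eventually_gt_at_top[of 0]]
  obtain M :: nat where "M > 0" and M: "\<And>s v y. s \<noteq> 0 \<Longrightarrow> \<bar>s\<bar> < int S \<Longrightarrow> Modules.additive y \<Longrightarrow>
           nrm (av {..<M} (\<lambda>t. v + y (int t) + e (- r s * (int t)\<^sup>2)) G) \<le> sqrt (2 * \<rho>) + \<rho>"
    by (auto simp: eventually_at_top_linorder abs_less_iff)
  \<comment> \<open>\<open>w0\<close> is a difference of two of the averaged shifts;
    \<open>w\<close> below adds the quadratic term \<open>q\<close> along \<open>e\<close>.\<close>
  define w0 where "w0 s t' t = x (k * (int t - int t')) + p (H * s)" for s and t' t :: nat
  have off_diagonal: "L (\<lambda>y. z y * av {..<M} (w0 s t') h y) \<le> \<sigma>" if s: "s \<noteq> 0" "\<bar>s\<bar> < int S" for s t'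
  proof -
    define q where "q t = e (r s * (f - (int t - int t')\<^sup>2))" for t
    define w where "w t = w0 s t' t + q t" for t
    have "z y * av {..<M} w F y = 0" for y
    proof (cases "y \<in> Z")
      case True
      then have "F (y + w t) = 0" for t
        using avoid[OF True s, of "int t - int t'"] by (simp add: F_def w_def w0_def q_def)
      then show ?thesis by (simp add: av_def)
    qed (simp add: z_def)
    \<comment> \<open>The vanishing average of \<open>F\<close> may be subtracted; the difference is
      then estimated through \<open>F = g + G\<close>.\<close>
    then have zero: "z y * av {..<M} (w0 s t') g y = z y * (av {..<M} (w0 s t') g y - av {..<M} w F y)" for y
      by (simp add: right_diff_distrib)
    have "nrm (av {..<M} w G) \<le> sqrt (2 * \<rho>) + \<rho>"
    proof -
      \<comment> \<open>With \<open>t - t'\<close> in place of \<open>t\<close>, the cross term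
        \<open>2 * r s * t' * t\<close> is linear in \<open>t\<close> and joins the homomorphism.
        This is the reason for uniformity in \<open>y\<close>.\<close>
      define y where "y \<tau> = x (k * \<tau>) + e (2 * r s * int t' * \<tau>)" for \<tau>
      have "Modules.additive y"
        by unfold_locales (simp add: y_def distrib_left Modules.additive.add[OF hom(1)] Modules.additive.add[OF hom(3)])
      moreover have "w = (\<lambda>t. (x (- (k * int t')) + p (H * s) + e (r s * (f - (int t')\<^sup>2))) + y (int t) + e (- r s * (int t)\<^sup>2))"
      proof
        fix t
        have "r s * (f - (int t - int t')\<^sup>2)
            = r s * (f - (int t')\<^sup>2) + 2 * r s * int t' * int t + - r s * (int t)\<^sup>2"
          by (simp add: power2_eq_square algebra_simps)
        then have "q t = e (r s * (f - (int t')\<^sup>2)) + e (2 * r s * int t' * int t) + e (- r s * (int t)\<^sup>2)"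
          unfolding q_def by (simp only: Modules.additive.add[OF hom(3)])
        moreover have "x (k * (int t - int t')) = x (- (k * int t')) + x (k * int t)"
          by (simp add: Modules.additive.add[OF hom(1), symmetric] algebra_simps)
        ultimately show "w t = (x (- (k * int t')) + p (H * s) + e (r s * (f - (int t')\<^sup>2))) + y (int t) + e (- r s * (int t)\<^sup>2)"
          unfolding w_def w0_def y_def by (simp add: algebra_simps)
      qed
      ultimately show ?thesis using M[OF s] by simp
    qed
    \<comment> \<open>Dropping \<open>q\<close> is cheap: its argument is a multiple of
      \<open>H\<close>, and \<open>g\<close> is nearly invariant under such shifts.\<close>
    moreover have "nrm (\<lambda>y. av {..<M} w g y - av {..<M} (w0 s t') g y) \<le> \<rho>"
    proof -
      have eq: "(\<lambda>y. av {..<M} w g y - av {..<M} (w0 s t') g y)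
          = (\<lambda>y. (\<Sum>t<M. sh (w0 s t' t) (\<lambda>x. sh (q t) g x - g x) y) / real (card {..<M}))"
        by (simp add: av_def sh_def w_def sum_subtractf diff_divide_distrib[symmetric] add.assoc)
      show ?thesis unfolding eq
      proof (rule nrm_average)
        fix t
        obtain j where "r s * (f - (int t - int t')\<^sup>2) = H * j"
          using r(2)[OF s] by (metis dvd_mult2 dvdE)
        then have "nrm (\<lambda>x. sh (q t) g x - g x) \<le> \<rho>" using inv[of j] by (simp add: q_def)
        then show "nrm (sh (w0 s t' t) (\<lambda>x. sh (q t) g x - g x)) \<le> \<rho>" by (subst nrm_sh) auto
      qed (use \<open>M > 0\<close> in auto)
    qed
    moreover have "nrm (\<lambda>y. av {..<M} (w0 s t') g y - av {..<M} w F y)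
        \<le> nrm (av {..<M} w G) + nrm (\<lambda>y. av {..<M} w g y - av {..<M} (w0 s t') g y)"
    proof -
      have eq: "(\<lambda>y. av {..<M} (w0 s t') g y - av {..<M} w F y)
          = (\<lambda>y. - 1 * (av {..<M} w G y + (av {..<M} w g y - av {..<M} (w0 s t') g y)))"
        by (simp add: av_def G_def sum_subtractf diff_divide_distrib)
      have "nrm (\<lambda>y. av {..<M} (w0 s t') g y - av {..<M} w F y) = nrm (\<lambda>y. av {..<M} w G y + (av {..<M} w g y - av {..<M} (w0 s t') g y))"
        unfolding eq by (subst nrm_scale) auto
      also have "\<dots> \<le> nrm (av {..<M} w G) + nrm (\<lambda>y. av {..<M} w g y - av {..<M} (w0 s t') g y)"
        by (rule nrm_add) auto
      finally show ?thesis .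
    qed
    ultimately have D: "nrm (\<lambda>y. av {..<M} (w0 s t') g y - av {..<M} w F y) \<le> \<sigma>"
      unfolding \<sigma>_def by linarith
    have "L (\<lambda>y. z y * av {..<M} (w0 s t') h y) \<le> L (\<lambda>y. z y * av {..<M} (w0 s t') g y)"
    proof (intro L_mono mult_left_mono z01)
      show "av {..<M} (w0 s t') h y \<le> av {..<M} (w0 s t') g y" for y
        unfolding av_def by (intro divide_right_mono sum_mono h_le_g) simp
    qed auto
    also have "\<dots> \<le> nrm z * nrm (\<lambda>y. av {..<M} (w0 s t') g y - av {..<M} w F y)"
      unfolding zero using Cauchy_Schwarz[of z "\<lambda>y. av {..<M} (w0 s t') g y - av {..<M} w F y"] by simp
    also have "\<dots> \<le> 1 * \<sigma>"
    proof (rule mult_mono[OF _ D])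
      show "nrm z \<le> 1" using z01 by (intro nrm_le_const) auto
    qed auto
    finally show ?thesis by simp
  qed
  have diagonal: "L (\<lambda>y. z y * av {..<M} (w0 s t') h y) \<le> 1" for s t'
  proof -
    have "z y * av {..<M} (w0 s t') h y \<le> 1" for y
    proof -
      have "h y \<le> 1" for y using h_le_g[of y] g01[of y] by linarith
      then have "(\<Sum>t<M. h (y + w0 s t' t)) \<le> (\<Sum>t<M. 1)" by (intro sum_mono) simp
      then have "av {..<M} (w0 s t') h y \<le> 1" using \<open>M > 0\<close> by (simp add: av_def)
      moreover have "z y = 0 \<or> z y = 1" by (auto simp: z_def indicator_def)
      ultimately show ?thesis by auto
    qed
    then have "L (\<lambda>y. z y * av {..<M} (w0 s t') h y) \<le> L (\<lambda>_. 1)" by (intro L_mono) auto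
    then show ?thesis by (simp add: L_one)
  qed
  have "\<sigma> \<ge> 0" using \<open>\<rho> > 0\<close> by (simp add: \<sigma>_def)
  define u where "u = (\<lambda>(t, i). x (k * int t) + p (H * int i))"
  define I where "I = {..<M} \<times> {..<S}"
  have u_diff: "u (t, i) - u (t', j) = w0 (int i - int j) t' t" for t i t' j
    by (simp add: u_def w0_def right_diff_distrib Modules.additive.diff[OF hom(1)] Modules.additive.diff[OF hom(2)])
  have split: "(\<Sum>\<alpha>\<in>I. P \<alpha>) = (\<Sum>t<M. \<Sum>i<S. P (t, i))" for P :: "nat \<times> nat \<Rightarrow> real"
    unfolding I_def sum.cartesian_product by simp
  have "(\<Sum>\<beta>\<in>I. \<Sum>\<alpha>\<in>I. L (\<lambda>y. z y * sh (u \<alpha> - u \<beta>) h y))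
      = (\<Sum>t'<M. \<Sum>j<S. \<Sum>t<M. \<Sum>i<S. L (\<lambda>y. z y * sh (w0 (int i - int j) t' t) h y))"
    unfolding split u_diff ..
  also have "\<dots> = (\<Sum>t'<M. \<Sum>j<S. \<Sum>i<S. \<Sum>t<M. L (\<lambda>y. z y * sh (w0 (int i - int j) t' t) h y))"
    by (intro sum.cong refl sum.swap)
  also have "\<dots> = (\<Sum>t'<M. \<Sum>j<S. \<Sum>i<S. real M * L (\<lambda>y. z y * av {..<M} (w0 (int i - int j) t') h y))"
  proof (intro sum.cong refl)
    fix t' j i
    have "(\<Sum>t<M. L (\<lambda>y. z y * sh (w0 (int i - int j) t' t) h y))
        = L (\<lambda>y. \<Sum>t<M. z y * sh (w0 (int i - int j) t' t) h y)"
      by (subst L_sum) auto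
    also have "\<dots> = L (\<lambda>y. real M * (z y * av {..<M} (w0 (int i - int j) t') h y))"
      using \<open>M > 0\<close> by (simp add: av_def sh_def sum_distrib_left[symmetric])
    finally show "(\<Sum>t<M. L (\<lambda>y. z y * sh (w0 (int i - int j) t' t) h y))
        = real M * L (\<lambda>y. z y * av {..<M} (w0 (int i - int j) t') h y)"
      by (simp add: L_scale)
  qed
  \<comment> \<open>Of the \<open>S^2\<close> pairs of \<open>j\<close> and \<open>i\<close>,
    \<open>S\<close> are diagonal, which yields \<open>1 / S\<close> after normalisation.\<close>
  also have "\<dots> \<le> (\<Sum>t'<M. \<Sum>j<S. \<Sum>i<S. real M * ((if i = j then 1 else 0) + \<sigma>))"
  proof (intro sum_mono mult_left_mono)
    fix t' j i assume "j \<in> {..<S}" "i \<in> {..<S}"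
    then show "L (\<lambda>y. z y * av {..<M} (w0 (int i - int j) t') h y) \<le> (if i = j then 1 else 0) + \<sigma>"
      using off_diagonal[of "int i - int j" t'] diagonal[of "int i - int j" t'] \<open>\<sigma> \<ge> 0\<close> by auto
  qed simp
  also have "\<dots> = (1 / real S + \<sigma>) * (real (card I))\<^sup>2"
    using \<open>S > 0\<close> by (simp add: I_def sum.distrib sum_distrib_left[symmetric] power2_eq_square field_simps)
  finally have "(nrm (av I u (ev a z)))\<^sup>2 \<le> 1 / real S + \<sigma>"
    using \<open>M > 0\<close> \<open>S > 0\<close> by (simp add: nrm_av_ev_square h_def[symmetric] pos_divide_le_eq I_def)
  \<comment> \<open>The lower bound: averaging preserves the mean of \<open>z\<close>, and a mean is
    at most the norm.\<close>
  moreover have "L z \<le> nrm (av I u (ev a z))"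
  proof -
    have "L z = L (av I u (ev a z))"
      using \<open>M > 0\<close> \<open>S > 0\<close> by (subst L_av) (auto simp: I_def L_ev)
    then show ?thesis using L_le_nrm[of "av I u (ev a z)"] by simp
  qed
  moreover have "0 \<le> L z" using z01 by (intro L_nonneg) auto
  ultimately show ?thesis
    unfolding z_def \<sigma>_def by (meson order_trans power_mono)
qed

text \<open>For each \<open>f\<close> the points of \<open>B\<close> without a return have mean
  below \<open>L (indicator B) / m\<close>, so \<open>m\<close> such sets cannot cover
  \<open>B\<close>. \<open>H\<close> and \<open>S\<close> come before \<open>Fs\<close> because the
  bound is uniform in \<open>f\<close>.\<close>

theorem quadratic_returns:
  fixes x p e :: "int \<Rightarrow> 'g" and B :: "'g set" and m :: nat
  assumes hom: "Modules.additive x" "Modules.additive p" "Modules.additive e"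
    and B: "0 < L (indicator B)" and "m > 0"
  obtains H :: int and S :: nat where "H > 0" "S > 0"
    "\<And>Fs. finite Fs \<Longrightarrow> card Fs = m \<Longrightarrow> \<exists>b\<in>B. \<forall>f\<in>Fs. \<exists>s t. s \<noteq> 0 \<and> \<bar>s\<bar> < int S \<and>
       b + (x (2 * H * fact S * t) + p (H * s) + e (H * ((fact S)\<^sup>2 div s) * (f - t\<^sup>2))) \<in> B"
proof -
  define \<delta> where "\<delta> = L (indicator B)"
  define \<gamma> where "\<gamma> = (\<delta> / m)\<^sup>2"
  \<comment> \<open>\<open>\<kappa>^2\<close> serves as \<open>\<rho>\<close>: the error term is at
    most \<open>4 * \<kappa> \<le> \<gamma> / 2\<close>, and \<open>1 / S\<close> stays below the
    other half of \<open>\<gamma>\<close>.\<close>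
  define \<kappa> where "\<kappa> = min 1 (\<gamma> / 8)"
  have "\<gamma> > 0" using B \<open>m > 0\<close> by (simp add: \<gamma>_def \<delta>_def)
  then have \<kappa>: "\<kappa> > 0" "\<kappa> \<le> 1" "\<kappa> \<le> \<gamma> / 8" by (auto simp: \<kappa>_def)
  then have "\<kappa>\<^sup>2 > 0" by simp
  have "sqrt (2 * \<kappa>\<^sup>2) \<le> 2 * \<kappa>"
    by (rule real_le_lsqrt) (use \<kappa> in \<open>auto simp: power2_eq_square\<close>)
  moreover have "\<kappa>\<^sup>2 \<le> \<kappa>" using \<kappa> by (simp add: power2_eq_square mult_left_le)
  ultimately have small: "sqrt (2 * \<kappa>\<^sup>2) + 2 * \<kappa>\<^sup>2 \<le> \<gamma> / 2" using \<kappa> by linarith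
  obtain S :: nat where S: "S > 0" "1 / real S < \<gamma> / 2"
    using real_arch_inverse[of "\<gamma> / 2"] \<open>\<gamma> > 0\<close> by (auto simp: inverse_eq_divide)
  have ind: "\<bar>indicator B y :: real\<bar> \<le> 1" for y by (simp add: indicator_def)
  obtain H a where H: "H > 0"
    "\<And>j. nrm (\<lambda>x. sh (e (H * j)) (ev (adj a) (ev a (indicator B))) x - ev (adj a) (ev a (indicator B)) x) \<le> \<kappa>\<^sup>2"
    "\<And>h \<epsilon>. h \<noteq> 0 \<Longrightarrow> H dvd h \<Longrightarrow> \<epsilon> > 0 \<Longrightarrow> \<forall>\<^sub>F M in sequentially.
       nrm (av {..<M} (\<lambda>t. e (h * int t)) (\<lambda>x. indicator B x - ev (adj a) (ev a (indicator B)) x)) \<le> \<kappa>\<^sup>2 + \<epsilon>"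
    using invariant_approximant[where F = "indicator B", OF hom(3) ind \<open>\<kappa>\<^sup>2 > 0\<close>] by blast
  define Z where "Z f = {b \<in> B. \<forall>s t. s \<noteq> 0 \<longrightarrow> \<bar>s\<bar> < int S \<longrightarrow>
       b + (x (2 * H * fact S * t) + p (H * s) + e (H * ((fact S)\<^sup>2 div s) * (f - t\<^sup>2))) \<notin> B}" for f
  have Z_small: "L (indicator (Z f)) < \<delta> / m" for f
  proof (rule power2_less_imp_less)
    have "(L (indicator (Z f)))\<^sup>2 \<le> 1 / real S + (sqrt (2 * \<kappa>\<^sup>2) + 2 * \<kappa>\<^sup>2)"
      by (rule bad_set_bound[OF hom H(1) S(1) \<open>\<kappa>\<^sup>2 > 0\<close> H(2,3), where f = f and k = "2 * H * fact S"])
         (auto simp: Z_def)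
    also have "\<dots> < (\<delta> / m)\<^sup>2" using small S by (simp add: \<gamma>_def)
    finally show "(L (indicator (Z f)))\<^sup>2 < (\<delta> / m)\<^sup>2" .
    show "0 \<le> \<delta> / m" using B by (simp add: \<delta>_def)
  qed
  have "\<exists>b\<in>B. \<forall>f\<in>Fs. b \<notin> Z f" if Fs: "finite Fs" "card Fs = m" for Fs
  proof (rule ccontr)
    assume "\<not> (\<exists>b\<in>B. \<forall>f\<in>Fs. b \<notin> Z f)"
    then have cover: "\<exists>f\<in>Fs. b \<in> Z f" if "b \<in> B" for b using that by blast
    have "(indicator B b :: real) \<le> (\<Sum>f\<in>Fs. indicator (Z f) b)" for b
    proof (cases "b \<in> B")
      case True
      then obtain f where "f \<in> Fs" "b \<in> Z f" using cover by blast
      then show ?thesis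
        using member_le_sum[of f Fs "\<lambda>f. indicator (Z f) b :: real"] Fs True by simp
    qed (simp add: sum_nonneg)
    then have "\<delta> \<le> L (\<lambda>b. \<Sum>f\<in>Fs. indicator (Z f) b)"
      unfolding \<delta>_def by (intro L_mono) auto
    also have "\<dots> = (\<Sum>f\<in>Fs. L (indicator (Z f)))" using Fs by (intro L_sum) auto
    also have "\<dots> < (\<Sum>f\<in>Fs. \<delta> / m)"
      using Fs \<open>m > 0\<close> Z_small by (intro sum_strict_mono) auto
    also have "\<dots> = \<delta>" using Fs \<open>m > 0\<close> by simp
    finally show False by simp
  qed
  then show ?thesis
    by (intro that[of H S] H S) (fastforce simp: Z_def)
qed

end

section \<open>Sets of positive upper Banach density\<close>

text \<open>The inner mean obeys the same bound as \<open>F\<close>, and a shift of the product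
  splits into shifts of the two factors.\<close>

lemma inv_mean_prod:
  assumes "inv_mean L1" "inv_mean L2"
  shows "inv_mean (\<lambda>F. L1 (\<lambda>x. L2 (\<lambda>y. F (x, y))))"
proof -
  interpret L1: inv_mean L1 by fact
  interpret L2: inv_mean L2 by fact
  have bd_slice: "bounded_fun (\<lambda>y. F (x, y))" if "bounded_fun F" for F :: "'a \<times> 'b \<Rightarrow> real" and x
    using that by (auto simp: bounded_fun_def)
  have bd: "bounded_fun (\<lambda>x. L2 (\<lambda>y. F (x, y)))" if F: "bounded_fun F" for F :: "'a \<times> 'b \<Rightarrow> real"
  proof -
    obtain C where C: "\<And>x. \<bar>F x\<bar> \<le> C" using bounded_funE[OF F] by blast
    have "\<bar>L2 (\<lambda>y. F (x, y))\<bar> \<le> C" for x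
    proof -
      have "L2 (\<lambda>y. F (x, y)) \<le> L2 (\<lambda>_. C)" "L2 (\<lambda>_. - C) \<le> L2 (\<lambda>y. F (x, y))"
        using C bd_slice[OF F] by (intro L2.L_mono; force simp: abs_le_iff minus_le_iff)+
      then show ?thesis by (simp add: L2.L_const)
    qed
    then show ?thesis by (rule bounded_funI)
  qed
  show ?thesis
  proof
    fix F :: "'a \<times> 'b \<Rightarrow> real" and v
    assume F: "bounded_fun F"
    have "(\<lambda>x. L2 (\<lambda>y. sh v F (x, y))) = (\<lambda>x. L2 (\<lambda>y. F (x + fst v, y)))"
    proof
      fix x
      have "(\<lambda>y. sh v F (x, y)) = sh (snd v) (\<lambda>y. F (x + fst v, y))"
        by (cases v) (simp add: sh_def fun_eq_iff)
      then show "L2 (\<lambda>y. sh v F (x, y)) = L2 (\<lambda>y. F (x + fst v, y))"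
        using L2.L_shift[OF bd_slice[OF F]] by simp
    qed
    also have "\<dots> = sh (fst v) (\<lambda>x. L2 (\<lambda>y. F (x, y)))" by (simp add: sh_def fun_eq_iff)
    finally show "L1 (\<lambda>x. L2 (\<lambda>y. sh v F (x, y))) = L1 (\<lambda>x. L2 (\<lambda>y. F (x, y)))"
      using L1.L_shift[OF bd[OF F]] by simp
  qed (simp_all add: bd bd_slice L1.L_add L2.L_add L1.L_scale L2.L_scale L1.L_one L2.L_one
        L1.L_nonneg L2.L_nonneg)
qed

section \<open>Invariant means as cluster points of window averages\<close>

lemma closed_cluster_point:
  assumes "inf (nhds l) (filtermap f F) \<noteq> bot" "closed C" "\<forall>\<^sub>F x in F. f x \<in> C"
  shows "l \<in> C"
proof (rule ccontr)
  assume "l \<notin> C"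
  then have "\<forall>\<^sub>F y in nhds l. y \<notin> C"
    using \<open>closed C\<close> by (auto simp: eventually_nhds closed_def intro!: exI[of _ "- C"])
  moreover have "\<forall>\<^sub>F y in filtermap f F. y \<in> C" using assms by (simp add: eventually_filtermap)
  ultimately have "\<forall>\<^sub>F y in inf (nhds l) (filtermap f F). False"
    unfolding eventually_inf by blast
  then show False using assms by (simp add: trivial_limit_def)
qed

text \<open>Puts window averages in the form of averages over \<open>2 * n + 1\<close> consecutive
  integers from \<open>c - n\<close> on, to which \<open>av_shift_close\<close> applies.\<close>

lemma av_window:
  "av {..<2 * n + 1} int F (c - int n) = (\<Sum>j\<in>window n. F (j + c)) / real (card (window n))"
proof -
  have "(\<Sum>t<2 * n + 1. F (c - int n + int t)) = (\<Sum>j\<in>window n. F (j + c))"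
    by (rule sum.reindex_bij_witness[of _ "\<lambda>j. nat (j + int n)" "\<lambda>t. int t - int n"])
       (auto simp: window_def algebra_simps)
  moreover have "card (window n) = 2 * n + 1" by (simp add: window_def)
  ultimately show ?thesis by (simp add: av_def)
qed

text \<open>The window averages are points of a compact product of intervals, one for each function.
  A cluster point along windows in which \<open>E\<close> has density at least \<open>d\<close> is
  the mean, as closed conditions pass to cluster points.\<close>

lemma invariant_mean_exists:
  assumes "upper_Banach_density E > 0"
  obtains L :: "(int \<Rightarrow> real) \<Rightarrow> real" where "inv_mean L" "L (indicator E) > 0"
proof -
  obtain c :: "nat \<Rightarrow> int" where c: "limsup (\<lambda>n. ereal (real (card (E \<inter> (\<lambda>j. j + c n) ` window n)) / real (card (window n)))) > 0"
    using assms unfolding upper_Banach_density_def less_SUP_iff by blast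
  \<comment> \<open>The value 0 at unbounded functions keeps every \<open>\<phi> n\<close> in the
    compact set \<open>K\<close> below.\<close>
  define \<phi> where "\<phi> n F = (if bounded_fun F then av {..<2 * n + 1} int F (c n - int n) else 0)"
    for n and F :: "int \<Rightarrow> real"
  have \<phi>_density: "\<phi> n (indicator E) = real (card (E \<inter> (\<lambda>j. j + c n) ` window n)) / real (card (window n))" for n
  proof -
    have "E \<inter> (\<lambda>j. j + c n) ` window n = (\<lambda>j. j + c n) ` {j \<in> window n. j + c n \<in> E}" by auto
    then have "card (E \<inter> (\<lambda>j. j + c n) ` window n) = card {j \<in> window n. j + c n \<in> E}"
      by (simp add: card_image inj_on_def)
    moreover have "finite (window n)" by (simp add: window_def)
    ultimately have "real (card (E \<inter> (\<lambda>j. j + c n) ` window n)) = (\<Sum>j\<in>window n. indicator E (j + c n))"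
      by (simp add: indicator_def sum.If_cases Int_def)
    then show ?thesis by (simp only: \<phi>_def av_window bounded_fun_indicator if_True)
  qed
  obtain d :: real where d: "0 < d" "ereal d < limsup (\<lambda>n. ereal (\<phi> n (indicator E)))"
    using ereal_dense2[OF c] unfolding \<phi>_density zero_ereal_def by (auto simp: less_ereal.simps)
  \<comment> \<open>The filter of late windows in which \<open>E\<close> has density at least
    \<open>d\<close>; it is proper because \<open>d\<close> lies strictly below the limsup.\<close>
  define \<F> where "\<F> = inf sequentially (principal {n. d \<le> \<phi> n (indicator E)})"
  have "\<F> \<noteq> bot"
  proof
    assume "\<F> = bot"
    then have "\<forall>\<^sub>F n in sequentially. \<phi> n (indicator E) \<le> d"
      unfolding \<F>_def trivial_limit_def eventually_inf_principal
      by (rule eventually_mono) auto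
    then have "limsup (\<lambda>n. ereal (\<phi> n (indicator E))) \<le> ereal d"
      by (intro Limsup_bounded) auto
    then show False using d by simp
  qed
  define b :: "(int \<Rightarrow> real) \<Rightarrow> real" where
    "b F = (SOME C. \<forall>x. \<bar>F x\<bar> \<le> C)" for F
  have b: "\<bar>F x\<bar> \<le> b F" if "bounded_fun F" for F x
    using someI_ex[of "\<lambda>C. \<forall>x. \<bar>F x\<bar> \<le> C"] that unfolding bounded_fun_def b_def by blast
  \<comment> \<open>\<open>b F\<close> is unspecified for unbounded \<open>F\<close>; the absolute
    value ensures that the interval contains 0.\<close>
  define K where "K = PiE UNIV (\<lambda>F. {- \<bar>b F\<bar>..\<bar>b F\<bar>})"
  have "compactin (product_topology (\<lambda>_. euclidean) UNIV) K"
    unfolding K_def compactin_PiE by auto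
  then have "compact K" unfolding euclidean_product_topology by simp
  have \<phi>_K: "\<phi> n \<in> K" for n
  proof -
    have "\<bar>\<phi> n F\<bar> \<le> \<bar>b F\<bar>" for F
    proof (cases "bounded_fun F")
      case True
      have "\<bar>\<Sum>t<2 * n + 1. F (c n - int n + int t)\<bar> \<le> (\<Sum>t<2 * n + 1. \<bar>b F\<bar>)"
        using b[OF True] by (intro order_trans[OF sum_abs] sum_mono) (meson abs_ge_self order_trans)
      then show ?thesis using True by (simp add: \<phi>_def av_def field_simps)
    qed (simp add: \<phi>_def)
    then show ?thesis by (auto simp: K_def PiE_def abs_le_iff minus_le_iff)
  qed
  obtain L where L: "inf (nhds L) (filtermap \<phi> \<F>) \<noteq> bot"
  proof -
    have "filtermap \<phi> \<F> \<noteq> bot" using \<open>\<F> \<noteq> bot\<close> by (simp add: filtermap_bot_iff)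
    moreover have "\<forall>\<^sub>F x in filtermap \<phi> \<F>. x \<in> K" by (simp add: eventually_filtermap \<phi>_K)
    ultimately show ?thesis using \<open>compact K\<close> that unfolding compact_filter by blast
  qed
  have limit: "P L" if "closed {l. P l}" "\<And>n. P (\<phi> n)" for P
    using closed_cluster_point[OF L that(1)] that(2) by simp
  note cont = continuous_on_add continuous_on_mult continuous_on_diff continuous_on_const continuous_on_rabs
    continuous_on_product_coordinates
  have "inv_mean L"
  proof
    fix F G :: "int \<Rightarrow> real" assume FG: "bounded_fun F" "bounded_fun G"
    show "L (\<lambda>x. F x + G x) = L F + L G"
    proof (rule limit)
      show "closed {l :: (int \<Rightarrow> real) \<Rightarrow> real. l (\<lambda>x. F x + G x) = l F + l G}"
        by (intro closed_Collect_eq cont)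
    qed (simp add: \<phi>_def FG av_def sum.distrib add_divide_distrib)
  next
    fix F :: "int \<Rightarrow> real" and r assume F: "bounded_fun F"
    show "L (\<lambda>x. r * F x) = r * L F"
    proof (rule limit)
      show "closed {l :: (int \<Rightarrow> real) \<Rightarrow> real. l (\<lambda>x. r * F x) = r * l F}"
        by (intro closed_Collect_eq cont)
    qed (simp add: \<phi>_def F bounded_fun_mult av_def sum_distrib_left distrib_left)
  next
    fix F :: "int \<Rightarrow> real" assume F: "bounded_fun F" "\<And>x. 0 \<le> F x"
    show "0 \<le> L F"
    proof (rule limit)
      show "closed {l :: (int \<Rightarrow> real) \<Rightarrow> real. 0 \<le> l F}"
        by (intro closed_Collect_le cont)
    qed (simp add: \<phi>_def F av_def sum_nonneg)
  next
    show "L (\<lambda>_. 1) = 1"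
    proof (rule limit)
      show "closed {l :: (int \<Rightarrow> real) \<Rightarrow> real. l (\<lambda>_. 1) = (1::real)}"
        by (intro closed_Collect_eq cont)
    qed (simp add: \<phi>_def av_def)
  next
    fix F :: "int \<Rightarrow> real" and v assume F: "bounded_fun F"
    obtain C where C: "\<And>x. \<bar>F x\<bar> \<le> C" using bounded_funE[OF F] by blast
    \<comment> \<open>A single window average is shift invariant only up to a boundary error, so
      invariance is shown for each \<open>\<epsilon>\<close> along the filter. The other laws hold
      exactly for every \<open>\<phi> n\<close>.\<close>
    have "\<bar>L F - L (sh v F)\<bar> \<le> \<epsilon>" if "\<epsilon> > 0" for \<epsilon>
    proof -
      have "Modules.additive (\<lambda>x::int. x)" by unfold_locales simp
      from av_shift_close[where F = F and C = C and h = 1 and j = v, OF this C]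
      have close: "\<bar>av {..<M} int F x - av {..<M} int (sh v F) x\<bar> \<le> 2 * \<bar>real_of_int v\<bar> * C / real M" for M x
        by simp
      have "\<bar>\<phi> n F - \<phi> n (sh v F)\<bar> \<le> 2 * \<bar>real_of_int v\<bar> * C / real (2 * n + 1)" for n
        using close[of "2 * n + 1" "c n - int n"] F by (simp only: \<phi>_def bounded_fun_sh if_True)
      moreover have "\<forall>\<^sub>F n in sequentially. 2 * \<bar>real_of_int v\<bar> * C / real (2 * n + 1) < \<epsilon>"
        using that by real_asymp
      ultimately have "\<forall>\<^sub>F n in sequentially. \<bar>\<phi> n F - \<phi> n (sh v F)\<bar> \<le> \<epsilon>"
        by (auto elim!: eventually_mono intro: order_trans less_imp_le)
      then have "\<forall>\<^sub>F n in \<F>. \<phi> n \<in> {l. \<bar>l F - l (sh v F)\<bar> \<le> \<epsilon>}"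
        unfolding \<F>_def eventually_inf_principal by (auto elim!: eventually_mono)
      moreover have "closed {l. \<bar>l F - l (sh v F)\<bar> \<le> \<epsilon>}"
        by (intro closed_Collect_le cont)
      ultimately show ?thesis using closed_cluster_point[OF L] by blast
    qed
    then have "\<bar>L F - L (sh v F)\<bar> \<le> 0" using field_le_epsilon[of "\<bar>L F - L (sh v F)\<bar>" 0] by simp
    then show "L (sh v F) = L F" by simp
  qed
  moreover have "d \<le> L (indicator E)"
  proof -
    have "closed {l. d \<le> l (indicator E)}" by (intro closed_Collect_le cont)
    moreover have "\<forall>\<^sub>F n in \<F>. \<phi> n \<in> {l. d \<le> l (indicator E)}"
      by (simp add: \<F>_def eventually_inf_principal)
    ultimately show ?thesis using closed_cluster_point[OF L] by blast
  qed
  ultimately show ?thesis using that d by force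
qed

text \<open>A point of \<open>E \<times> E \<times> E\<close> that returns along a quadratic curve
  gives \<open>u\<close>, \<open>v\<close>, \<open>w\<close>, since the displacement lies on the
  required quadric. \<open>k\<close> is fixed before \<open>Fs\<close>.\<close>

theorem density_quadratic_patterns:
  assumes E: "upper_Banach_density E > 0" and "m > 0"
  shows "\<exists>k::nat. k > 0 \<and> (\<forall>Fs::int set. finite Fs \<and> card Fs = m \<longrightarrow>
     (\<exists>x\<in>E. \<exists>y\<in>E. \<exists>z\<in>E. (\<lambda>f. (int k)\<^sup>2 * f) ` Fs \<subseteq>
        {(u - x)\<^sup>2 + (v - y)\<^sup>2 - (w - z)\<^sup>2 | u v w. u \<in> E \<and> v \<in> E \<and> w \<in> E}))"
proof -
  obtain L0 :: "(int \<Rightarrow> real) \<Rightarrow> real" where L0: "inv_mean L0" "L0 (indicator E) > 0"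
    using invariant_mean_exists[OF E] .
  define L where "L F = L0 (\<lambda>x. L0 (\<lambda>y. L0 (\<lambda>z. F (x, y, z))))" for F :: "int \<times> int \<times> int \<Rightarrow> real"
  interpret L0: inv_mean L0 by fact
  have "inv_mean L"
    using inv_mean_prod[OF L0(1) inv_mean_prod[OF L0(1) L0(1)]] unfolding L_def[abs_def] by simp
  then interpret inv_mean L .
  define B where "B = E \<times> E \<times> E"
  have "L (indicator B) = (L0 (indicator E)) ^ 3"
  proof -
    have "indicator B (x, y, z) = indicator E x * (indicator E y * (indicator E z :: real))" for x y z
      by (auto simp: B_def indicator_def)
    then have "L (indicator B) = L0 (\<lambda>x. indicator E x * L0 (\<lambda>y. indicator E y * L0 (indicator E)))"
      unfolding L_def by (simp add: L0.L_scale bounded_fun_mult)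
    also have "\<dots> = L0 (\<lambda>x. (L0 (indicator E) * L0 (indicator E)) * indicator E x)"
      by (simp add: mult.commute[of "indicator E _"] L0.L_scale)
    also have "\<dots> = (L0 (indicator E)) ^ 3" by (simp add: L0.L_scale power3_eq_cube)
    finally show ?thesis .
  qed
  then have B: "0 < L (indicator B)" using L0 by simp
  \<comment> \<open>\<open>P\<close> and \<open>Q\<close> run along the two null lines of
    \<open>v^2 - w^2\<close>: on \<open>P s + Q r\<close> this form is
    \<open>4 * s * r\<close>.\<close>
  define X P Q :: "int \<Rightarrow> int \<times> int \<times> int" where
    "X t = (t, 0, 0)" "P s = (0, s, - s)" "Q r = (0, r, r)" for t s r
  have hom: "Modules.additive X" "Modules.additive P" "Modules.additive Q"
    by (unfold_locales; simp add: X_P_Q_def)+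
  define good where "good H S b f \<longleftrightarrow> (\<exists>s t. s \<noteq> 0 \<and> \<bar>s\<bar> < int S \<and>
       b + (X (2 * H * fact S * t) + P (H * s) + Q (H * ((fact S)\<^sup>2 div s) * (f - t\<^sup>2))) \<in> B)"
    for H S b f
  obtain H :: int and S :: nat where HS: "H > 0" "S > 0" and ret:
    "\<And>Fs. finite Fs \<Longrightarrow> card Fs = m \<Longrightarrow> \<exists>b\<in>B. \<forall>f\<in>Fs. good H S b f"
    using quadratic_returns[OF hom B \<open>m > 0\<close>] unfolding good_def by blast
  define k where "k = nat (2 * H * fact S)"
  have k: "int k = 2 * H * fact S" "k > 0" using HS by (simp_all add: k_def)
  show ?thesis
  proof (intro exI[of _ k] conjI k allI impI)
    fix Fs :: "int set" assume "finite Fs \<and> card Fs = m"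
    then obtain b where b: "b \<in> B" "\<And>f. f \<in> Fs \<Longrightarrow> good H S b f"
      using ret by blast
    obtain x y z where xyz: "b = (x, y, z)" "x \<in> E" "y \<in> E" "z \<in> E" using b(1) by (auto simp: B_def)
    have "\<exists>u v w. (int k)\<^sup>2 * f = (u - x)\<^sup>2 + (v - y)\<^sup>2 - (w - z)\<^sup>2 \<and> u \<in> E \<and> v \<in> E \<and> w \<in> E"
      if "f \<in> Fs" for f
    proof -
      obtain s t where st: "s \<noteq> 0" "\<bar>s\<bar> < int S"
        "b + (X (2 * H * fact S * t) + P (H * s) + Q (H * ((fact S)\<^sup>2 div s) * (f - t\<^sup>2))) \<in> B"
        using b(2)[OF \<open>f \<in> Fs\<close>] unfolding good_def by blast
      define r where "r = H * ((fact S)\<^sup>2 div s) * (f - t\<^sup>2)"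
      have "s dvd (fact S)\<^sup>2" using int_dvd_fact[of s S] st by (simp add: power2_eq_square)
      then have div: "(fact S)\<^sup>2 div s * s = (fact S)\<^sup>2" by simp
      \<comment> \<open>The factor \<open>s\<close> cancels the denominator in \<open>r\<close>;
        what remains in \<open>t^2\<close> cancels against the first coordinate.\<close>
      have "(H * s + r)\<^sup>2 - (r - H * s)\<^sup>2 = 4 * H\<^sup>2 * ((fact S)\<^sup>2 div s * s) * (f - t\<^sup>2)"
        by (simp add: r_def power2_eq_square algebra_simps)
      then have "(2 * H * fact S * t)\<^sup>2 + (H * s + r)\<^sup>2 - (r - H * s)\<^sup>2 = (int k)\<^sup>2 * f"
        unfolding div k(1) by (simp add: power2_eq_square algebra_simps)
      moreover have "x + 2 * H * fact S * t \<in> E" "y + (H * s + r) \<in> E" "z + (r - H * s) \<in> E"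
        using st(3) unfolding r_def[symmetric] by (simp_all add: X_P_Q_def B_def xyz algebra_simps)
      ultimately show ?thesis
        by (intro exI[of _ "x + 2 * H * fact S * t"] exI[of _ "y + (H * s + r)"] exI[of _ "z + (r - H * s)"]) simp
    qed
    then have "(\<lambda>f. (int k)\<^sup>2 * f) ` Fs \<subseteq>
        {(u - x)\<^sup>2 + (v - y)\<^sup>2 - (w - z)\<^sup>2 | u v w. u \<in> E \<and> v \<in> E \<and> w \<in> E}" by blast
    then show "\<exists>x\<in>E. \<exists>y\<in>E. \<exists>z\<in>E. (\<lambda>f. (int k)\<^sup>2 * f) ` Fs \<subseteq>
        {(u - x)\<^sup>2 + (v - y)\<^sup>2 - (w - z)\<^sup>2 | u v w. u \<in> E \<and> v \<in> E \<and> w \<in> E}"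
      using xyz by blast
  qed
qed

section \<open>Dense homomorphisms to connected compact groups\<close>

locale dense_hom =
  fixes \<tau> :: "int \<Rightarrow> 'k::{topological_ab_group_add, t2_space}"
  assumes compact: "compact (UNIV :: 'k set)" and connected: "connected (UNIV :: 'k set)"
    and hom: "Modules.additive \<tau>" and dense: "closure (range \<tau>) = UNIV"
begin

section \<open>Density of multiples and equidistribution\<close>

lemma open_translate:
  assumes "open (V :: 'k set)"
  shows "open {x. x + c \<in> V}"
  using open_vimage[OF assms, of "\<lambda>x. x + c"] by (simp add: vimage_def continuous_intros)

lemma closed_translate:
  assumes "closed (V :: 'k set)"
  shows "closed {x. x + c \<in> V}"
  using open_translate[of "- V" c] assms by (simp add: closed_def Collect_neg_eq)

text \<open>The closure of \<open>\<tau>(h\<int>)\<close> is a closed subgroup of finite index, hence open.\<close>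

lemma dense_multiples:
  assumes "h \<noteq> 0"
  shows "closure (range (\<lambda>j. \<tau> (h * j))) = UNIV"
proof -
  define D where "D = closure (range (\<lambda>j. \<tau> (h * j)))"
  \<comment> \<open>The coset of \<open>D\<close> through \<open>\<tau> i\<close>, written as a
    preimage under a translation so that it is closed.\<close>
  define C where "C i = {x. x + \<tau> (- i) \<in> D}" for i
  have closed_C: "closed (C i)" for i unfolding C_def D_def by (intro closed_translate closed_closure)
  have D_diff: "x - y \<in> D" if "x \<in> D" "y \<in> D" for x y
  proof -
    let ?S = "range (\<lambda>j. \<tau> (h * j))"
    have "(\<lambda>z. fst z - snd z) ` closure (?S \<times> ?S) \<subseteq> D"
    proof (rule image_closure_subset)
      show "continuous_on (closure (?S \<times> ?S)) (\<lambda>z. fst z - snd z)"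
        by (intro continuous_intros)
      have "\<tau> (h * i) - \<tau> (h * j) = \<tau> (h * (i - j))" for i j
        by (simp add: Modules.additive.diff[OF hom] right_diff_distrib)
      then have "\<tau> (h * i) - \<tau> (h * j) \<in> ?S" for i j by (rule range_eqI)
      then have "(\<lambda>z. fst z - snd z) ` (?S \<times> ?S) \<subseteq> ?S" by (simp add: image_subset_iff)
      then show "(\<lambda>z. fst z - snd z) ` (?S \<times> ?S) \<subseteq> D"
        unfolding D_def by (rule subset_trans[OF _ closure_subset])
    qed (simp add: D_def)
    moreover have "(x, y) \<in> closure (?S \<times> ?S)" using that by (simp add: closure_Times D_def)
    ultimately have "fst (x, y) - snd (x, y) \<in> D" by (rule subsetD[OF _ imageI])
    then show ?thesis by simp
  qed
  have mem_D: "\<tau> (h * j) \<in> D" for j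
    unfolding D_def by (rule subsetD[OF closure_subset]) (rule rangeI)
  have D_0: "0 \<in> D" using mem_D[of 0] by (simp add: Modules.additive.zero[OF hom])
  then have D_minus: "- y \<in> D" if "y \<in> D" for y using D_diff[of 0 y] that by simp
  then have D_add: "x + y \<in> D" if "x \<in> D" "y \<in> D" for x y using D_diff[of x "- y"] that by simp
  have cover: "UNIV = (\<Union>i\<in>{0..<\<bar>h\<bar>}. C i)"
  proof -
    have "\<tau> n \<in> (\<Union>i\<in>{0..<\<bar>h\<bar>}. C i)" for n
    proof
      show "n mod \<bar>h\<bar> \<in> {0..<\<bar>h\<bar>}" using assms by simp
      have "n - n mod \<bar>h\<bar> = \<bar>h\<bar> * (n div \<bar>h\<bar>)" by (simp add: minus_mod_eq_mult_div)
      then have "n - n mod \<bar>h\<bar> = h * (sgn h * (n div \<bar>h\<bar>))" by (simp add: abs_sgn mult.assoc)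
      then have "\<tau> n + \<tau> (- (n mod \<bar>h\<bar>)) = \<tau> (h * (sgn h * (n div \<bar>h\<bar>)))"
        by (simp add: Modules.additive.add[OF hom, symmetric])
      also have "\<dots> \<in> D" by (rule mem_D)
      finally show "\<tau> n \<in> C (n mod \<bar>h\<bar>)" by (simp add: C_def)
    qed
    moreover have "closed (\<Union>i\<in>{0..<\<bar>h\<bar>}. C i)" using closed_C by auto
    ultimately have "closure (range \<tau>) \<subseteq> (\<Union>i\<in>{0..<\<bar>h\<bar>}. C i)"
      by (intro closure_minimal) auto
    then show ?thesis unfolding dense by (intro subset_antisym subset_UNIV)
  qed
  \<comment> \<open>A coset that meets \<open>D\<close> lies in \<open>D\<close>, so the complement
    is a finite union of closed cosets.\<close>
  have "- D = (\<Union>i\<in>{i\<in>{0..<\<bar>h\<bar>}. C i \<inter> D = {}}. C i)"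
  proof -
    have "C i \<subseteq> D" if ne: "C i \<inter> D \<noteq> {}" for i
    proof
      fix x assume "x \<in> C i"
      obtain y where y: "y + \<tau> (- i) \<in> D" "y \<in> D" using ne by (auto simp: C_def)
      then have "(y + \<tau> (- i)) - y \<in> D" by (intro D_diff)
      then have "\<tau> (- i) \<in> D" by simp
      moreover have "x + \<tau> (- i) \<in> D" using \<open>x \<in> C i\<close> by (simp add: C_def)
      ultimately have "(x + \<tau> (- i)) - \<tau> (- i) \<in> D" by (intro D_diff)
      then show "x \<in> D" by simp
    qed
    then show ?thesis using cover by blast
  qed
  moreover have "finite {i\<in>{0..<\<bar>h\<bar>}. C i \<inter> D = {}}"
    by (rule finite_subset[of _ "{0..<\<bar>h\<bar>}"]) auto
  ultimately have "closed (- D)" using closed_C by (simp only: closed_UN ball_triv HOL.simp_thms)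
  then have "open D" by (simp add: closed_def)
  moreover have "closed D" by (simp add: D_def)
  ultimately have "D = {} \<or> D = UNIV" using connected unfolding connected_clopen by auto
  then show ?thesis using D_0 by (auto simp: D_def)
qed

text \<open>By density every point is moved into \<open>V\<close> by some
  \<open>\<tau> (h * j)\<close>; compactness leaves finitely many \<open>j\<close> for all
  points.\<close>

lemma finite_translates_cover:
  assumes "h \<noteq> 0" "open V" "0 \<in> V"
  obtains J where "finite J" "\<And>x. \<exists>j\<in>J. x + \<tau> (h * j) \<in> V"
proof -
  have "\<exists>j. x + \<tau> (h * j) \<in> V" for x
  proof -
    have "open {y. y + x \<in> V}" using assms by (intro open_translate)
    moreover have "- x \<in> {y. y + x \<in> V}" using assms by simp
    moreover have "- x \<in> closure (range (\<lambda>j. \<tau> (h * j)))" using dense_multiples[OF \<open>h \<noteq> 0\<close>] by simp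
    ultimately have "{y. y + x \<in> V} \<inter> range (\<lambda>j. \<tau> (h * j)) \<noteq> {}"
      unfolding closure_iff_nhds_not_empty by blast
    then show ?thesis by (auto simp: add.commute)
  qed
  then have cover: "UNIV \<subseteq> (\<Union>j. {x. x + \<tau> (h * j) \<in> V})" by auto
  show ?thesis
  proof (rule compactE_image[OF compact _ cover])
    fix J
    assume J: "finite J" "UNIV \<subseteq> (\<Union>j\<in>J. {x. x + \<tau> (h * j) \<in> V})"
    have "\<exists>j\<in>J. x + \<tau> (h * j) \<in> V" for x using subsetD[OF J(2) UNIV_I[of x]] by simp
    with J(1) show ?thesis by (rule that)
  qed (rule open_translate[OF \<open>open V\<close>])
qed

text \<open>No metric is at hand. The tube lemma applies to the open set \<open>W\<close>, which
  contains \<open>{0} \<times> UNIV\<close> with compact second factor.\<close>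

lemma uniformly_continuous:
  fixes \<psi> :: "'k \<Rightarrow> real"
  assumes "continuous_on UNIV \<psi>" "\<epsilon> > 0"
  obtains V where "open V" "0 \<in> V" "\<And>x v. v \<in> V \<Longrightarrow> \<bar>\<psi> (x + v) - \<psi> x\<bar> < \<epsilon>"
proof -
  define W where "W = {z. \<bar>\<psi> (snd z + fst z) - \<psi> (snd z)\<bar> < \<epsilon>}"
  have "open W" unfolding W_def
    by (intro open_Collect_less continuous_intros continuous_on_compose2[OF assms(1)]) auto
  then have "openin (prod_topology euclidean euclidean) W"
    by simp
  moreover have "compactin euclidean (UNIV :: 'k set)" using compact by simp
  moreover have "{0} \<times> UNIV \<subseteq> W" using \<open>\<epsilon> > 0\<close> by (auto simp: W_def)
  ultimately obtain V V' where "open V" "0 \<in> V" "UNIV \<subseteq> V'" "V \<times> V' \<subseteq> W"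
    using tube_lemma_right[of euclidean euclidean W UNIV 0] by auto
  then show ?thesis using that[of V] by (force simp: W_def)
qed

lemma bounded_fun_continuous:
  fixes \<psi> :: "'k \<Rightarrow> real"
  assumes "continuous_on UNIV \<psi>"
  shows "bounded_fun \<psi>"
proof -
  have "bounded (range \<psi>)"
    using compact_continuous_image[OF assms compact] by (rule compact_imp_bounded)
  then show ?thesis by (auto simp: bounded_iff bounded_fun_def)
qed

text \<open>Averages along \<open>\<tau>(h\<int>)\<close> change little under the shifts \<open>\<tau>(hj)\<close> with \<open>j\<close> in a finite set,
  and these shifts come close to every element of the group.\<close>

lemma average_equidistributes:
  fixes \<psi> :: "'k \<Rightarrow> real"
  assumes "inv_mean L" "continuous_on UNIV \<psi>" "h \<noteq> 0" "\<epsilon> > 0"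
  shows "\<forall>\<^sub>F N in sequentially. \<forall>n. \<bar>av {..<N} (\<lambda>t. h * int t) (\<psi> \<circ> \<tau>) n - L (\<psi> \<circ> \<tau>)\<bar> \<le> \<epsilon>"
proof -
  interpret inv_mean L by fact
  obtain C where C: "C \<ge> 0" "\<And>x. \<bar>\<psi> x\<bar> \<le> C" using bounded_fun_continuous[OF assms(2)] by (rule bounded_funE) blast
  obtain V where V: "open V" "0 \<in> V" "\<And>x v. v \<in> V \<Longrightarrow> \<bar>\<psi> (x + v) - \<psi> x\<bar> < \<epsilon> / 2"
    using uniformly_continuous[OF assms(2) half_gt_zero[OF \<open>\<epsilon> > 0\<close>]] by blast
  obtain J where J: "finite J" "\<And>x. \<exists>j\<in>J. x + \<tau> (h * j) \<in> V"
    using finite_translates_cover[OF \<open>h \<noteq> 0\<close> V(1,2)] by blast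
  let ?A = "\<lambda>N. av {..<N} (\<lambda>t. \<tau> (h * int t)) \<psi>"
  have "\<forall>\<^sub>F N in sequentially. \<forall>j\<in>J. 2 * \<bar>real_of_int j\<bar> * C / real N < \<epsilon> / 2"
    using J \<open>\<epsilon> > 0\<close> by (intro eventually_ball_finite ballI) (auto, real_asymp)
  with eventually_gt_at_top[of 0] show ?thesis
  proof eventually_elim
    case (elim N)
    \<comment> \<open>For \<open>j\<close> from the finite set, \<open>x + \<tau> (h * j)\<close>
      equals \<open>y + v\<close> with a small \<open>v\<close>: the shift by
      \<open>\<tau> (h * j)\<close> hardly changes the average, and the shift by \<open>v\<close>
      hardly changes the values of \<open>\<psi>\<close>.\<close>
    have osc: "\<bar>?A N x - ?A N y\<bar> \<le> \<epsilon>" for x y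
    proof -
      obtain j where j: "j \<in> J" "(x - y) + \<tau> (h * j) \<in> V" using J(2) by blast
      define v where "v = (x - y) + \<tau> (h * j)"
      have "\<bar>?A N (y + v) - ?A N y\<bar> \<le> \<epsilon> / 2"
      proof -
        have "\<bar>\<Sum>t<N. \<psi> ((y + \<tau> (h * int t)) + v) - \<psi> (y + \<tau> (h * int t))\<bar> \<le> (\<Sum>t<N. \<epsilon> / 2)"
          by (intro order_trans[OF sum_abs] sum_mono less_imp_le[OF V(3)]) (use j in \<open>simp add: v_def\<close>)
        then show ?thesis using elim
          by (simp add: av_def sum_subtractf diff_divide_distrib[symmetric] field_simps)
      qed
      moreover have "?A N (y + v) = av {..<N} (\<lambda>t. \<tau> (h * int t)) (sh (\<tau> (h * j)) \<psi>) x"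
        by (simp add: v_def av_def sh_def algebra_simps)
      then have "\<bar>?A N x - ?A N (y + v)\<bar> \<le> \<epsilon> / 2"
        using av_shift_close[where F = \<psi> and C = C and h = h and j = j and M = N and x = x, OF hom C(2)] elim j
        by fastforce
      ultimately show ?thesis by linarith
    qed
    have A_eq: "av {..<N} (\<lambda>t. h * int t) (\<psi> \<circ> \<tau>) n = ?A N (\<tau> n)" for n
      by (simp add: av_def Modules.additive.add[OF hom])
    have bd: "bounded_fun (\<psi> \<circ> \<tau>)" using C by (intro bounded_funI[of _ C]) simp
    show ?case
    proof
      fix n
      let ?a = "av {..<N} (\<lambda>t. h * int t) (\<psi> \<circ> \<tau>)"
      have "L ?a = L (\<psi> \<circ> \<tau>)" using elim bd by (intro L_av) auto
      \<comment> \<open>The average is nearly constant and has mean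
        \<open>L (\<psi> \<circ> \<tau>)\<close>, so the constant is close to this number.\<close>
      moreover have "L ?a \<le> L (\<lambda>_. ?a n + \<epsilon>)" "L (\<lambda>_. ?a n - \<epsilon>) \<le> L ?a"
        using osc[of "\<tau> n" "\<tau> _"] bd unfolding A_eq
        by (intro L_mono; force simp: abs_le_iff A_eq[symmetric] algebra_simps)+
      ultimately show "\<bar>?a n - L (\<psi> \<circ> \<tau>)\<bar> \<le> \<epsilon>" by (simp add: L_const abs_le_iff)
    qed
  qed
qed

text \<open>Finitely many translates of \<open>{x. 1 / 2 < \<psi> x}\<close> cover the group, so a
  finite sum of shifts of \<open>\<psi> \<circ> \<tau>\<close> is at least \<open>1 / 2\<close>, and
  all of these have the same mean.\<close>

lemma mean_positive:
  fixes \<psi> :: "'k \<Rightarrow> real"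
  assumes "inv_mean L" "continuous_on UNIV \<psi>" "\<And>x. 0 \<le> \<psi> x" "\<psi> 0 = 1"
  shows "0 < L (\<psi> \<circ> \<tau>)"
proof -
  interpret inv_mean L by fact
  have bd: "bounded_fun (\<psi> \<circ> \<tau>)"
    using bounded_fun_continuous[OF assms(2)] by (auto simp: bounded_fun_def)
  have "open {x. 1 / 2 < \<psi> x}" using assms(2) by (intro open_Collect_less continuous_intros)
  then obtain J where J: "finite J" "\<And>x. \<exists>j\<in>J. x + \<tau> (1 * j) \<in> {x. 1 / 2 < \<psi> x}"
    using finite_translates_cover[of 1 "{x. 1 / 2 < \<psi> x}"] assms(4) by auto
  have "1 / 2 \<le> (\<Sum>j\<in>J. sh j (\<psi> \<circ> \<tau>) n)" for n
  proof -
    obtain j where j: "j \<in> J" "1 / 2 < \<psi> (\<tau> n + \<tau> j)" using J(2)[of "\<tau> n"] by auto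
    then have "1 / 2 < sh j (\<psi> \<circ> \<tau>) n" by (simp add: sh_def Modules.additive.add[OF hom])
    also have "\<dots> \<le> (\<Sum>j\<in>J. sh j (\<psi> \<circ> \<tau>) n)"
      using j J assms(3) by (intro member_le_sum) (auto simp: sh_def)
    finally show ?thesis by simp
  qed
  then have "L (\<lambda>_. 1 / 2) \<le> L (\<lambda>n. \<Sum>j\<in>J. sh j (\<psi> \<circ> \<tau>) n)"
    using bd by (intro L_mono) auto
  also have "\<dots> = card J * L (\<psi> \<circ> \<tau>)" using J bd by (subst L_sum) (auto simp: L_shift)
  finally show ?thesis by (metis L_const half_gt_zero_iff less_le_trans mult_nonneg_nonpos not_le of_nat_0_le_iff zero_less_one)
qed

text \<open>On \<open>\<int> \<times> \<int>\<close> the first coordinate carries the linear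
  sequence, the second the quadratic one. For a bump function \<open>\<psi>\<close> at 0, put
  \<open>f = \<psi> \<circ> \<tau>\<close> with mean \<open>I\<close>. Then \<open>f x * f z\<close>
  is the sum of \<open>G\<close>, whose quadratic averages are negligible, and
  \<open>I * f x\<close>, whose linear averages are close to \<open>I^2\<close>. So some
  \<open>w\<close> and \<open>w + u t\<close> both lie in the support, and differences of points of
  \<open>W\<close> lie in \<open>V\<close>.\<close>

lemma quadratic_linear_return:
  fixes A b c l d :: int
  assumes "A \<noteq> 0" "l \<noteq> 0" "open V" "0 \<in> V"
  obtains t :: nat where "\<tau> (A * (int t)\<^sup>2 + b * int t + c) \<in> V" "\<tau> (l * int t + d) \<in> V"
proof -
  have "open ((\<lambda>z. snd z - fst z) -` V)"
    using \<open>open V\<close> by (intro open_vimage continuous_intros)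
  moreover have "(0, 0) \<in> (\<lambda>z. snd z - fst z) -` V" using \<open>0 \<in> V\<close> by simp
  ultimately obtain W1 W2 where W12: "open W1" "open W2" "(0, 0) \<in> W1 \<times> W2" "W1 \<times> W2 \<subseteq> (\<lambda>z. snd z - fst z) -` V"
    by (rule open_prod_elim)
  define W where "W = W1 \<inter> W2"
  have W: "open W" "0 \<in> W" "\<And>x y. x \<in> W \<Longrightarrow> y \<in> W \<Longrightarrow> y - x \<in> V" using W12 by (auto simp: W_def)
  have "Hausdorff_space (euclidean :: 'k topology)"
    unfolding Hausdorff_space_def disjnt_def using hausdorff by auto
  then have "normal_space (euclidean :: 'k topology)"
    using compact by (intro compact_Hausdorff_or_regular_imp_normal_space) (auto simp: compact_space_def)
  then obtain \<psi> :: "'k \<Rightarrow> real" where \<psi>: "continuous_map euclidean (top_of_set {0..1}) \<psi>"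
      "\<psi> ` (- W) \<subseteq> {0}" "\<psi> ` {0} \<subseteq> {1}"
    using Urysohn_lemma[of euclidean "- W" "{0}" 0 1] W by (auto simp: disjnt_def closed_def)
  have cont: "continuous_on UNIV \<psi>" and \<psi>01: "0 \<le> \<psi> x" "\<psi> x \<le> 1" for x
    using \<psi>(1) by (auto simp: continuous_map_in_subtopology)
  have \<psi>W: "x \<in> W" if "\<psi> x \<noteq> 0" for x using \<psi>(2) that by auto
  \<comment> \<open>Serves to obtain some invariant mean on \<open>\<int>\<close>.\<close>
  have "upper_Banach_density UNIV > 0"
  proof -
    have "(0::ereal) < limsup (\<lambda>n. ereal (real (card (UNIV \<inter> (\<lambda>j. j + (\<lambda>_. 0) n) ` window n)) / real (card (window n))))"
      by (simp add: window_def Limsup_const)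
    also have "\<dots> \<le> upper_Banach_density UNIV"
      unfolding upper_Banach_density_def by (intro SUP_upper) simp
    finally show ?thesis .
  qed
  then obtain L0 :: "(int \<Rightarrow> real) \<Rightarrow> real" where L0: "inv_mean L0"
    using invariant_mean_exists by blast
  interpret L0: inv_mean L0 by fact
  define L where "L F = L0 (\<lambda>x. L0 (\<lambda>z. F (x, z)))" for F :: "int \<times> int \<Rightarrow> real"
  have "inv_mean L" using inv_mean_prod[OF L0 L0] unfolding L_def[abs_def] by simp
  then interpret inv_mean L .
  define f where "f = \<psi> \<circ> \<tau>"
  define I where "I = L0 f"
  define F where "F = (\<lambda>(x, z). f x * f z)"
  define G where "G = (\<lambda>(x, z). f x * (f z - I))"
  have f01: "0 \<le> f x" "f x \<le> 1" for x by (auto simp: f_def \<psi>01)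
  have bf [simp]: "bounded_fun f" using f01 by (intro bounded_funI[of _ 1]) (auto simp: abs_le_iff intro: order_trans[of _ 0])
  have "0 < I" unfolding I_def f_def
    using L0 cont \<psi>01 \<psi>(3) by (intro mean_positive) auto
  have "I \<le> 1" using L0.L_mono[of f "\<lambda>_. 1"] f01 by (simp add: I_def L0.L_one)
  have F01: "0 \<le> F w" "F w \<le> 1" for w using f01 by (auto simp: F_def mult_le_one split: prod.splits)
  have G1: "\<bar>G w\<bar> \<le> 1" for w
  proof -
    have "\<bar>f z - I\<bar> \<le> 1" for z using f01[of z] \<open>0 < I\<close> \<open>I \<le> 1\<close> by linarith
    then show ?thesis using f01 by (auto simp: G_def abs_mult mult_le_one split: prod.splits)
  qed
  have bF [simp]: "bounded_fun F" "bounded_fun G"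
    using G1 F01 by (auto intro!: bounded_funI[of _ 1] simp: abs_le_iff intro: order_trans[of _ 0])
  have LF: "L F = I\<^sup>2"
    unfolding L_def F_def using L0.L_scale[of f "I"] by (simp add: L0.L_scale I_def power2_eq_square mult.commute)
  define e where "e z = (0 :: int, z :: int)" for z
  have e: "Modules.additive e" by unfold_locales (simp add: e_def)
  \<comment> \<open>Without a return, \<open>I^4 \<le> \<kappa> + \<kappa>^2 + \<kappa>^2 * I^3
    \<le> 3 * \<kappa>\<close>, which contradicts \<open>\<kappa> \<le> I^4 / 4\<close>.\<close>
  define \<kappa> where "\<kappa> = min 1 (I ^ 4 / 4)"
  have \<kappa>: "0 < \<kappa>" "\<kappa> \<le> 1" "\<kappa> \<le> I ^ 4 / 4" using \<open>0 < I\<close> by (auto simp: \<kappa>_def)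
  have sqrt_\<kappa>: "sqrt (0 + \<kappa>\<^sup>2) = \<kappa>" using \<kappa> by simp
  \<comment> \<open>Here \<open>\<rho> = 0\<close>: by equidistribution along every nonzero
    \<open>h\<close>, subtracting \<open>I\<close> removes the whole invariant part.\<close>
  have "\<forall>\<^sub>F M in sequentially. \<forall>v y. Modules.additive y \<longrightarrow>
           nrm (av {..<M} (\<lambda>t. v + y (int t) + e (A * (int t)\<^sup>2)) G) \<le> sqrt (0 + \<kappa>\<^sup>2) + \<kappa>\<^sup>2"
  proof (rule quadratic_average_small[OF e G1 \<open>A \<noteq> 0\<close>])
    fix h :: int and \<epsilon> :: real assume h: "h \<noteq> 0" "\<epsilon> > 0"
    from average_equidistributes[OF L0 cont h]
    show "\<forall>\<^sub>F M in sequentially. nrm (av {..<M} (\<lambda>t. e (h * int t)) G) \<le> 0 + \<epsilon>"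
      using eventually_gt_at_top[of 0]
    proof eventually_elim
      case (elim M)
      have "\<bar>av {..<M} (\<lambda>t. e (h * int t)) G w\<bar> \<le> \<epsilon>" for w
      proof (cases w)
        case (Pair x z)
        have "av {..<M} (\<lambda>t. e (h * int t)) G w = f x * (av {..<M} (\<lambda>t. h * int t) f z - I)"
          using elim unfolding Pair
          by (simp add: av_def e_def G_def sum_distrib_left[symmetric] sum_subtractf)
             (simp add: field_simps)
        moreover have "\<bar>av {..<M} (\<lambda>t. h * int t) f z - I\<bar> \<le> \<epsilon>" using elim by (simp add: f_def I_def)
        ultimately show ?thesis
          using f01[of x] mult_mono[of "f x" 1 "\<bar>av {..<M} (\<lambda>t. h * int t) f z - I\<bar>" \<epsilon>]
          by (simp add: abs_mult)
      qed
      then show ?case by (simp add: nrm_le_const)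
    qed
  qed (use \<kappa> in auto)
  moreover have "\<forall>\<^sub>F N in sequentially. \<forall>n. \<bar>av {..<N} (\<lambda>t. l * int t) f n - I\<bar> \<le> \<kappa>\<^sup>2"
    unfolding f_def I_def using \<kappa> by (intro average_equidistributes[OF L0 cont \<open>l \<noteq> 0\<close>]) auto
  ultimately have "\<forall>\<^sub>F M in sequentially. (\<forall>v y. Modules.additive y \<longrightarrow>
           nrm (av {..<M} (\<lambda>t. v + y (int t) + e (A * (int t)\<^sup>2)) G) \<le> \<kappa> + \<kappa>\<^sup>2)
      \<and> (\<forall>n. \<bar>av {..<M} (\<lambda>t. l * int t) f n - I\<bar> \<le> \<kappa>\<^sup>2) \<and> M > 0"
    using eventually_gt_at_top[of 0] unfolding sqrt_\<kappa> by eventually_elim blast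
  then obtain M where M: "\<And>v y. Modules.additive y \<Longrightarrow>
           nrm (av {..<M} (\<lambda>t. v + y (int t) + e (A * (int t)\<^sup>2)) G) \<le> \<kappa> + \<kappa>\<^sup>2"
      "\<And>n. \<bar>av {..<M} (\<lambda>t. l * int t) f n - I\<bar> \<le> \<kappa>\<^sup>2" "M > 0"
    using eventually_happens'[OF sequentially_bot] by blast
  define u where "u t = (l * int t + d, A * (int t)\<^sup>2 + b * int t + c)" for t :: nat
  have uG: "nrm (av {..<M} u G) \<le> \<kappa> + \<kappa>\<^sup>2"
  proof -
    have "Modules.additive (\<lambda>s. (l * s, b * s))" by unfold_locales (simp add: algebra_simps)
    moreover have "u = (\<lambda>t. (d, c) + (l * int t, b * int t) + e (A * (int t)\<^sup>2))"
      by (simp add: u_def e_def fun_eq_iff)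
    ultimately show ?thesis using M(1)[of "\<lambda>s. (l * s, b * s)" "(d, c)"] by simp
  qed
  have "\<exists>t w. F w * F (w + u t) \<noteq> 0"
  proof (rule ccontr)
    assume "\<not> ?thesis"
    then have F0: "F w * F (w + u t) = 0" for w t by blast
    have "F w * I * (I - \<kappa>\<^sup>2) \<le> - (F w * av {..<M} u G w)" for w
    proof (cases w)
      case (Pair x z)
      have "F w * av {..<M} u F w = 0"
        unfolding av_def times_divide_eq_right sum_distrib_left F0 by simp
      moreover have "av {..<M} u F w = av {..<M} u G w + I * av {..<M} (\<lambda>t. l * int t) f (x + d)"
        using M(3) unfolding Pair
        by (simp add: av_def u_def F_def G_def sum_distrib_left sum.distrib[symmetric] add_divide_distrib[symmetric] algebra_simps)
      ultimately have "- (F w * av {..<M} u G w) = F w * I * av {..<M} (\<lambda>t. l * int t) f (x + d)"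
        by (simp add: algebra_simps)
      moreover have "I - \<kappa>\<^sup>2 \<le> av {..<M} (\<lambda>t. l * int t) f (x + d)"
        using M(2)[of "x + d"] by linarith
      ultimately show ?thesis using F01[of w] \<open>0 < I\<close> by (simp add: mult_left_mono)
    qed
    then have "L (\<lambda>w. (I * (I - \<kappa>\<^sup>2)) * F w) \<le> L (\<lambda>w. (- 1) * (F w * av {..<M} u G w))"
      by (intro L_mono) (auto simp: mult_ac)
    also have "\<dots> = - L (\<lambda>w. F w * av {..<M} u G w)"
      using L_scale[of "\<lambda>w. F w * av {..<M} u G w" "- 1"] by simp
    also have "\<dots> \<le> nrm F * nrm (av {..<M} u G)"
      using Cauchy_Schwarz[of F "av {..<M} u G"] by simp
    also have "\<dots> \<le> 1 * (\<kappa> + \<kappa>\<^sup>2)"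
    proof (rule mult_mono[OF _ uG])
      show "nrm F \<le> 1" using F01 by (intro nrm_le_const) auto
    qed auto
    finally have "I * (I - \<kappa>\<^sup>2) * I\<^sup>2 \<le> \<kappa> + \<kappa>\<^sup>2" by (simp add: L_scale LF)
    moreover have "I * (I - \<kappa>\<^sup>2) * I\<^sup>2 = I ^ 4 - \<kappa>\<^sup>2 * I ^ 3"
      by (simp add: power2_eq_square power3_eq_cube power4_eq_xxxx algebra_simps)
    moreover have "\<kappa>\<^sup>2 * I ^ 3 \<le> \<kappa> * 1"
      using \<kappa> \<open>0 < I\<close> \<open>I \<le> 1\<close> by (intro mult_mono) (auto simp: power2_eq_square mult_left_le power_le_one)
    moreover have "\<kappa>\<^sup>2 \<le> \<kappa>" using \<kappa> by (simp add: power2_eq_square mult_left_le)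
    ultimately show False using \<kappa> by linarith
  qed
  then obtain t x z where "f x * f z * (f (x + (l * int t + d)) * f (z + (A * (int t)\<^sup>2 + b * int t + c))) \<noteq> 0"
    by (auto simp: F_def u_def)
  then have "\<tau> x \<in> W" "\<tau> z \<in> W" "\<tau> (x + (l * int t + d)) \<in> W" "\<tau> (z + (A * (int t)\<^sup>2 + b * int t + c)) \<in> W"
    by (auto simp: f_def intro!: \<psi>W)
  then have "\<tau> (x + (l * int t + d)) - \<tau> x \<in> V" "\<tau> (z + (A * (int t)\<^sup>2 + b * int t + c)) - \<tau> z \<in> V"
    using W(3) by blast+
  then show ?thesis using that[of t] by (simp add: Modules.additive.diff[OF hom, symmetric])
qed

text \<open>With \<open>m = n - T^2\<close>, the expression
  \<open>u^2 + (m - w)^2 - w^2 = u^2 + m * (m - 2 * w)\<close> equals \<open>n\<close> identically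
  in \<open>r\<close>. Varying \<open>T\<close> makes \<open>\<tau> m\<close> small, then varying
  \<open>r\<close> makes \<open>\<tau> u\<close> and \<open>\<tau> w\<close> small.\<close>

lemma every_integer_represented:
  assumes "open U" "0 \<in> U"
  shows "\<exists>u\<in>\<tau> -` U. \<exists>v\<in>\<tau> -` U. \<exists>w\<in>\<tau> -` U. n = u\<^sup>2 + v\<^sup>2 - w\<^sup>2"
proof -
  have "open ((\<lambda>z. fst z - snd z) -` U)"
    using \<open>open U\<close> by (intro open_vimage continuous_intros)
  moreover have "(0, 0) \<in> (\<lambda>z. fst z - snd z) -` U" using \<open>0 \<in> U\<close> by simp
  ultimately obtain V1 V2 where V12: "open V1" "open V2" "(0, 0) \<in> V1 \<times> V2" "V1 \<times> V2 \<subseteq> (\<lambda>z. fst z - snd z) -` U"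
    by (rule open_prod_elim)
  \<comment> \<open>Differences of points of \<open>V\<close> lie in \<open>U\<close>, as
    \<open>m - w\<close> requires.\<close>
  define V where "V = V1 \<inter> V2 \<inter> U"
  have V: "open V" "0 \<in> V" "V \<subseteq> U" "\<And>x y. x \<in> V \<Longrightarrow> y \<in> V \<Longrightarrow> x - y \<in> U"
    using V12 assms by (auto simp: V_def)
  have nz: "(- 4 :: int) \<noteq> 0" "(1 :: int) \<noteq> 0" by simp_all
  obtain j :: nat where "\<tau> (- 4 * (int j)\<^sup>2 + (- 4 * (n + 1)) * int j + (n - (n + 1)\<^sup>2)) \<in> V"
    using quadratic_linear_return[OF nz V(1,2), where b = "- 4 * (n + 1)" and c = "n - (n + 1)\<^sup>2"] by blast
  \<comment> \<open>\<open>T\<close> has the parity of \<open>n + 1\<close>, which makes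
    \<open>m\<close> odd; this provides \<open>q\<close> and
    \<open>2 * m \<noteq> 0\<close>.\<close>
  moreover define T where "T = n + 1 + 2 * int j"
  moreover define m where "m = n - T\<^sup>2"
  moreover have "m = - 4 * (int j)\<^sup>2 + (- 4 * (n + 1)) * int j + (n - (n + 1)\<^sup>2)"
    by (simp add: m_def T_def power2_eq_square algebra_simps)
  ultimately have m: "\<tau> m \<in> V" by simp
  have "odd m" by (simp add: m_def T_def)
  then obtain q where q: "m = 2 * q + 1" by (rule oddE)
  have "2 * m \<noteq> 0" using \<open>odd m\<close> by auto
  then obtain r' :: nat where r': "\<tau> (2 * m * (int r')\<^sup>2 + 2 * T * int r' + q) \<in> V" "\<tau> (2 * m * int r' + T) \<in> V"
    using quadratic_linear_return[OF \<open>2 * m \<noteq> 0\<close> \<open>2 * m \<noteq> 0\<close> V(1,2), where b = "2 * T" and c = q and d = T] by blast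
  define r where "r = int r'"
  define u w where "u = 2 * m * r + T" "w = 2 * m * r\<^sup>2 + 2 * T * r + q"
  have "\<tau> (m - w) \<in> U" using V(4)[OF m r'(1)] by (simp add: u_w_def r_def Modules.additive.diff[OF hom])
  moreover have "\<tau> u \<in> U" "\<tau> w \<in> U" using r' V(3) by (auto simp: u_w_def r_def)
  moreover have "n = u\<^sup>2 + (m - w)\<^sup>2 - w\<^sup>2"
  proof -
    have "u\<^sup>2 + (m - w)\<^sup>2 - w\<^sup>2 = u\<^sup>2 + m * (m - 2 * w)"
      by (simp add: power2_eq_square algebra_simps)
    also have "m - 2 * w = 1 - 4 * m * r\<^sup>2 - 4 * T * r"
      by (simp add: u_w_def q algebra_simps)
    also have "u\<^sup>2 + m * (1 - 4 * m * r\<^sup>2 - 4 * T * r) = T\<^sup>2 + m"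
      by (simp add: u_w_def power2_eq_square algebra_simps)
    finally show ?thesis by (simp add: m_def)
  qed
  ultimately show ?thesis by auto
qed

end

theorem mainTheorem2:
  fixes E\<^sub>o :: "int set"
  shows "(upper_Banach_density E\<^sub>o > 0 \<longrightarrow>
            (\<forall>m::nat. m > 0 \<longrightarrow>
              (\<exists>k::nat. k > 0 \<and>
                (\<forall>F::int set. finite F \<and> card F = m \<longrightarrow>
                  (\<exists>x\<in>E\<^sub>o. \<exists>y\<in>E\<^sub>o. \<exists>z\<in>E\<^sub>o.
                    (\<lambda>f. (int k)\<^sup>2 * f) ` F \<subseteq>
                      {(u - x)\<^sup>2 + (v - y)\<^sup>2 - (w - z)\<^sup>2 | u v w.
                         u \<in> E\<^sub>o \<and> v \<in> E\<^sub>o \<and> w \<in> E\<^sub>o})))))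
       \<and> (aperiodic_Bohr_o TYPE('k::{topological_ab_group_add, t2_space, second_countable_topology}) E\<^sub>o \<longrightarrow>
            (\<forall>n::int. \<exists>u\<in>E\<^sub>o. \<exists>v\<in>E\<^sub>o. \<exists>w\<in>E\<^sub>o. n = u\<^sup>2 + v\<^sup>2 - w\<^sup>2))"
proof (intro conjI impI allI)
  fix m :: nat
  assume "upper_Banach_density E\<^sub>o > 0" "m > 0"
  then show "\<exists>k::nat. k > 0 \<and>
      (\<forall>F::int set. finite F \<and> card F = m \<longrightarrow>
        (\<exists>x\<in>E\<^sub>o. \<exists>y\<in>E\<^sub>o. \<exists>z\<in>E\<^sub>o.
          (\<lambda>f. (int k)\<^sup>2 * f) ` F \<subseteq>
            {(u - x)\<^sup>2 + (v - y)\<^sup>2 - (w - z)\<^sup>2 | u v w.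
               u \<in> E\<^sub>o \<and> v \<in> E\<^sub>o \<and> w \<in> E\<^sub>o}))"
    by (rule density_quadratic_patterns)
next
  fix n :: int
  assume Bohr: "aperiodic_Bohr_o TYPE('k) E\<^sub>o"
  then obtain \<tau> :: "int \<Rightarrow> 'k" and U where
    \<tau>: "\<forall>a b. \<tau> (a + b) = \<tau> a + \<tau> b" "closure (range \<tau>) = UNIV"
    and U: "open U" "0 \<in> U" "E\<^sub>o = \<tau> -` U"
    unfolding aperiodic_Bohr_o_def by blast
  interpret dense_hom \<tau>
    using Bohr \<tau> unfolding aperiodic_Bohr_o_def by unfold_locales auto
  show "\<exists>u\<in>E\<^sub>o. \<exists>v\<in>E\<^sub>o. \<exists>w\<in>E\<^sub>o. n = u\<^sup>2 + v\<^sup>2 - w\<^sup>2"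
    using every_integer_represented[OF U(1,2), of n] unfolding U(3) .
qed

end
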